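(* Let $d_1,d_2\in\mathbb{C}$ with $(d_1,d_2)\neq(0,0)$, let $n\in\mathbb{N}\cup\{0\}$ and $\alpha\in\mathbb{C}$. Then the function $$u_n(x,\alpha)=-\frac{\Delta_{n+1}(x,\alpha-2)\,\Delta_n(x,\alpha)}{\Delta_{n+1}(x,\alpha)\,\Delta_n(x,\alpha-2)}$$ solves the Painlevé III equation $$u_n''=\frac{(u_n')^2}{u_n}-\frac{u_n'}{x}+\frac{(\alpha+2n)u_n^2+(-\alpha+2+2n)}{x}+u_n^3-\frac{1}{u_n},$$ where $'$ denotes $d/dx$.
   Context: $J_\nu(x)$ and $Y_\nu(x)$ are the Bessel functions of the first and second kind (principal branches, $-\pi<\arg x<\pi$), and $\mathcal{C}_\nu(x)=d_1J_\nu(x)+d_2Y_\nu(x)$ with the constants $d_1,d_2\in\mathbb{C}$ independent of $\nu$. For $n\in\mathbb{N}=\{1,2,\dots\}$, $$\Delta_n(x,\alpha)=\det\left(\left\{\mathcal{C}_{\frac{\alpha}{2}-j+k}(x)\right\}_{j,k=0}^{n-1}\right),\qquad \Delta_0(x,\alpha)=1.$$ The function $u_n$ is regarded as a meromorphic function of $x$ on $\mathbb{C}\setminus(-\infty,0]$; the equation holds as an identity of meromorphic functions. *)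

theory Defs
  imports
    "HOL-Complex_Analysis.Complex_Analysis"
    "Jordan_Normal_Form.Determinant"
begin

text \<open>
  Bessel functions of complex order. The entire function \<^const>\<open>rGamma\<close> (the reciprocal of Gamma)
  makes the series meaningful for every order, including the negative integers;
  \<^const>\<open>powr\<close> on the complex numbers is the principal branch.
\<close>

definition Bessel_J :: "complex \<Rightarrow> complex \<Rightarrow> complex" where
  "Bessel_J \<nu> x = (x / 2) powr \<nu> *
     (\<Sum>k. (-1) ^ k * rGamma (\<nu> + of_nat k + 1) / fact k * (x / 2) ^ (2 * k))"

text \<open>At an integer order the defining quotient of the second kind is replaced by its limit.\<close>

definition Bessel_Y :: "complex \<Rightarrow> complex \<Rightarrow> complex" where
  "Bessel_Y \<nu> x =
     (let Q = (\<lambda>\<mu>. (Bessel_J \<mu> x * cos (\<mu> * of_real pi) - Bessel_J (- \<mu>) x) / sin (\<mu> * of_real pi))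
      in if \<nu> \<in> \<int> then Lim (at \<nu>) Q else Q \<nu>)"

definition cylinder :: "complex \<Rightarrow> complex \<Rightarrow> complex \<Rightarrow> complex \<Rightarrow> complex" where
  "cylinder d1 d2 \<nu> x = d1 * Bessel_J \<nu> x + d2 * Bessel_Y \<nu> x"

definition Bessel_det :: "complex \<Rightarrow> complex \<Rightarrow> nat \<Rightarrow> complex \<Rightarrow> complex \<Rightarrow> complex" where
  "Bessel_det d1 d2 n x \<alpha> =
     Determinant.det (Matrix.mat n n (\<lambda>(j, k). cylinder d1 d2 (\<alpha> / 2 - of_nat j + of_nat k) x))"

definition Bessel_u :: "complex \<Rightarrow> complex \<Rightarrow> nat \<Rightarrow> complex \<Rightarrow> complex \<Rightarrow> complex" where
  "Bessel_u d1 d2 n x \<alpha> =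
     - (Bessel_det d1 d2 (n + 1) x (\<alpha> - 2) * Bessel_det d1 d2 n x \<alpha>)
       / (Bessel_det d1 d2 (n + 1) x \<alpha> * Bessel_det d1 d2 n x (\<alpha> - 2))"

end

theory Submission
  imports Defs
begin

text \<open>
  Put \<open>\<nu> = \<alpha> / 2\<close> and write \<open>D n \<nu>\<close> for the Toeplitz determinant. Differentiating a row of \<open>D n \<nu>\<close>
  by \<open>C\<^sub>\<nu>' = C\<^sub>\<nu>\<^sub>-\<^sub>1 - (\<nu> / x) C\<^sub>\<nu>\<close> turns it into the next row, up to a diagonal term, so only the last
  row contributes, and Jacobi's identity evaluates the Wronskians of neighbouring determinants.
  The other recurrence \<open>C\<^sub>\<nu>' = (\<nu> / x) C\<^sub>\<nu> - C\<^sub>\<nu>\<^sub>+\<^sub>1\<close> gives a second set by \<open>\<nu> \<mapsto> - \<nu>\<close>. These Wronskians make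
  \<open>u\<close> and \<open>P = x (log (D (n + 1) \<nu> / D (n + 1) (\<nu> - 1)))'\<close> solve a first order system from
  which eliminating \<open>P\<close> gives Painleve III. They also show by induction on \<open>n\<close> that no determinant vanishes
  identically, once \<open>C\<^sub>\<nu>\<close> does not. At integer orders the recurrences of \<open>Y\<^sub>\<nu>\<close> follow from those at
  the surrounding circle of orders by the mean value property in \<open>\<nu>\<close>.
\<close>

text \<open>The same-size Wronskians bring in determinants of size \<open>n + 2\<close>, so the
  sizes \<open>n\<close> and \<open>n + 1\<close> alone give no closed system. It closes because the
  two recurrences evaluate the same Wronskian in two ways: \<open>P\<close> has one form with
  \<open>D (n + 2) (\<nu> - 1)\<close> and another with \<open>D (n + 2) \<nu>\<close>.
  Differentiating the first form produces \<open>D (n + 2) \<nu>\<close>, which the second form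
  converts back into \<open>P\<close>.

  Division is total, so the equation has content only where the determinants in \<open>u\<close> are
  nonzero; hence the need to exclude identical vanishing.

  For the second kind at integer order the obstacle is to exchange a limit in the order with a
  derivative in \<open>x\<close>. An average over a circle free of integers turns this into
  differentiation under an integral, which asks for continuity in order and argument
  jointly.\<close>

unbundle no vec_syntax
unbundle no fps_syntax

section \<open>Jacobi's identity for minors of the adjugate\<close>

lemma replace_col_carrier: "M \<in> carrier_mat n n \<Longrightarrow> replace_col M w k \<in> carrier_mat n n"
  by (auto simp: replace_col_def)

text \<open>The cofactors of column \<open>k\<close> do not see the entries of that column, so
  Laplace expansion along it is linear in \<open>w\<close>.\<close>

lemma det_replace_col:
  fixes M :: "'a::comm_ring_1 mat"
  assumes M: "M \<in> carrier_mat n n" and k: "k < n"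
  shows "Determinant.det (replace_col M w k) = (\<Sum>i<n. w $ i * cofactor M i k)"
proof -
  have "mat_delete (replace_col M w k) i k = mat_delete M i k" if "i < n" for i
    using M that k by (auto simp: mat_delete_def replace_col_def intro!: eq_matI)
  then show ?thesis
    using M k by (subst laplace_expansion_column[OF replace_col_carrier[OF M] k])
      (auto intro!: sum.cong simp: replace_col_def cofactor_def)
qed

lemma det_replace_col_unit:
  fixes M :: "'a::comm_ring_1 mat"
  assumes M: "M \<in> carrier_mat n n" and "i < n" "k < n"
  shows "Determinant.det (replace_col M (unit_vec n i) k) = cofactor M i k"
proof -
  have "(\<Sum>r<n. unit_vec n i $ r * cofactor M r k) = (\<Sum>r<n. if r = i then cofactor M r k else 0)"
    using assms by (intro sum.cong) auto
  then show ?thesis using assms by (simp add: det_replace_col)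
qed

text \<open>Polarisation: expanding the vanishing determinant with \<open>a + b\<close> in both
  columns leaves the two mixed terms. Nothing is halved, so this works in every commutative
  ring.\<close>

lemma det_replace_col_swap:
  fixes M :: "'a::comm_ring_1 mat"
  assumes M: "M \<in> carrier_mat n n" and jk: "j < n" "k < n" "j \<noteq> k"
    and ab: "a \<in> carrier_vec n" "b \<in> carrier_vec n"
  shows "Determinant.det (replace_col (replace_col M b k) a j) =
    - Determinant.det (replace_col (replace_col M a k) b j)"
proof -
  define \<phi> where "\<phi> a b = Determinant.det (replace_col (replace_col M b k) a j)" for a b
  have carr: "replace_col (replace_col M b k) a j \<in> carrier_mat n n" for a b
    by (intro replace_col_carrier M)
  have comm: "replace_col (replace_col M b k) a j = replace_col (replace_col M a j) b k" for a b
    using M jk by (auto simp: replace_col_def)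
  have addl: "\<phi> (a + a') b = \<phi> a b + \<phi> a' b" if "a' \<in> carrier_vec n" for a a' b
    unfolding \<phi>_def det_replace_col[OF replace_col_carrier[OF M] jk(1)]
    using that by (simp add: sum.distrib algebra_simps)
  have addr: "\<phi> a (b + b') = \<phi> a b + \<phi> a b'" if "b' \<in> carrier_vec n" for a b b'
    unfolding \<phi>_def comm det_replace_col[OF replace_col_carrier[OF M] jk(2)]
    using that by (simp add: sum.distrib algebra_simps)
  have alt: "\<phi> a a = 0" if "a \<in> carrier_vec n" for a
    unfolding \<phi>_def using M jk that
    by (intro det_identical_columns[OF carr jk(3)]) (auto simp: replace_col_def)
  have "\<phi> (a + b) (a + b) = 0" using ab by (intro alt) auto
  then have "\<phi> a b + \<phi> b a = 0"
    using addl[OF ab(2), of a "a + b"] addr[OF ab(2), of a a] addr[OF ab(2), of b a] alt[OF ab(1)] alt[OF ab(2)]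
    by simp
  then show ?thesis by (simp add: \<phi>_def eq_neg_iff_add_eq_0)
qed

text \<open>Applying Cramer's rule to the matrix with one replaced column avoids the usual division
  by \<open>det M\<close>.\<close>

lemma jacobi_adjugate_minor:
  fixes M :: "'a::comm_ring_1 mat"
  assumes M: "M \<in> carrier_mat n n" and ij: "i < n" "j < n" "i' < n" "j' < n" "j \<noteq> j'"
  shows "Determinant.det M * cofactor (replace_col M (unit_vec n i') j') i j =
    cofactor M i j * cofactor M i' j' - cofactor M i j' * cofactor M i' j"
proof -
  define M' where "M' = replace_col M (unit_vec n i') j'"
  have M': "M' \<in> carrier_mat n n" using M by (simp add: M'_def replace_col_carrier)
  \<comment> \<open>\<open>M\<close> sends column \<open>i\<close> of its adjugate to
    \<open>det M\<close> times the unit vector \<open>i\<close>, even when \<open>M\<close> is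
    singular.\<close>
  define y where "y = col (adj_mat M) i"
  have y: "y \<in> carrier_vec n" using adj_mat(1)[OF M] by (auto simp: y_def)
  have yc: "y $ c = cofactor M i c" if "c < n" for c
    using M that ij by (simp add: y_def adj_mat_def)
  have My: "M *\<^sub>v y = Determinant.det M \<cdot>\<^sub>v unit_vec n i"
  proof (rule eq_vecI)
    fix r assume r: "r < dim_vec (Determinant.det M \<cdot>\<^sub>v unit_vec n i)"
    have "(M * adj_mat M) $$ (r, i) = (Determinant.det M \<cdot>\<^sub>m 1\<^sub>m n) $$ (r, i)"
      using adj_mat(2)[OF M] by simp
    then show "(M *\<^sub>v y) $ r = (Determinant.det M \<cdot>\<^sub>v unit_vec n i) $ r"
      using r ij M adj_mat(1)[OF M] by (auto simp: y_def)
  qed (use M in auto)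
  have M'y: "(M' *\<^sub>v y) $ r = Determinant.det M * unit_vec n i $ r
      - y $ j' * M $$ (r, j') + y $ j' * unit_vec n i' $ r" if r: "r < n" for r
  proof -
    have "(M' *\<^sub>v y) $ r = (\<Sum>c\<in>{0..<n}. M' $$ (r, c) * y $ c)"
      using M' y r by (auto simp: scalar_prod_def intro!: sum.cong)
    also have "\<dots> = M' $$ (r, j') * y $ j' + (\<Sum>c\<in>{0..<n} - {j'}. M' $$ (r, c) * y $ c)"
      using ij by (subst sum.remove[of _ j']) auto
    also have "(\<Sum>c\<in>{0..<n} - {j'}. M' $$ (r, c) * y $ c) = (\<Sum>c\<in>{0..<n} - {j'}. M $$ (r, c) * y $ c)"
      using M r by (intro sum.cong) (auto simp: M'_def replace_col_def)
    also have "\<dots> = (\<Sum>c\<in>{0..<n}. M $$ (r, c) * y $ c) - M $$ (r, j') * y $ j'"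
      using ij by (subst sum.remove[of "{0..<n}" j']) auto
    also have "(\<Sum>c\<in>{0..<n}. M $$ (r, c) * y $ c) = (M *\<^sub>v y) $ r"
      using M y r by (auto simp: scalar_prod_def intro!: sum.cong)
    also have "M' $$ (r, j') = unit_vec n i' $ r"
      using M r ij by (simp add: M'_def replace_col_def)
    finally show ?thesis using r by (simp add: My algebra_simps)
  qed
  have dup: "cofactor M' i' j = 0"
  proof -
    have "Determinant.det (replace_col M' (unit_vec n i') j) = 0"
      using M ij by (intro det_identical_columns[OF replace_col_carrier[OF M'] ij(5)])
        (auto simp: M'_def replace_col_def)
    then show ?thesis using det_replace_col_unit[OF M' ij(3,2)] by simp
  qed
  \<comment> \<open>Exchanging columns \<open>j\<close> and \<open>j'\<close> moves column
    \<open>j'\<close> of \<open>M\<close> back to its place, leaving \<open>M\<close> with only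
    column \<open>j\<close> replaced.\<close>
  have swap: "(\<Sum>r<n. M $$ (r, j') * cofactor M' r j) = - cofactor M i' j"
  proof -
    have "(\<Sum>r<n. M $$ (r, j') * cofactor M' r j) = Determinant.det (replace_col M' (col M j') j)"
      using M ij by (auto simp: det_replace_col[OF M' ij(2)] intro!: sum.cong)
    also have "\<dots> = - Determinant.det (replace_col (replace_col M (col M j') j') (unit_vec n i') j)"
      unfolding M'_def using M ij by (intro det_replace_col_swap) auto
    also have "replace_col M (col M j') j' = M"
      using M by (auto simp: replace_col_def)
    finally show ?thesis using det_replace_col_unit[OF M ij(3,2)] by simp
  qed
  \<comment> \<open>Cramer's rule for \<open>M'\<close>, whose determinant is the cofactor of
    \<open>M\<close> at \<open>(i', j')\<close>; the replaced column is then split into the three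
    parts of \<open>M'y\<close>.\<close>
  have "y $ j * cofactor M i' j' = Determinant.det (replace_col M' (M' *\<^sub>v y) j)"
    using cramer_lemma_mat[OF M' y ij(2)] det_replace_col_unit[OF M ij(3,4)] by (simp add: M'_def)
  also have "\<dots> = (\<Sum>r<n. (Determinant.det M * unit_vec n i $ r
      - y $ j' * M $$ (r, j') + y $ j' * unit_vec n i' $ r) * cofactor M' r j)"
    by (simp add: det_replace_col[OF M' ij(2)] M'y cong: sum.cong_simp)
  also have "\<dots> = Determinant.det M * (\<Sum>r<n. unit_vec n i $ r * cofactor M' r j)
      - y $ j' * (\<Sum>r<n. M $$ (r, j') * cofactor M' r j)
      + y $ j' * (\<Sum>r<n. unit_vec n i' $ r * cofactor M' r j)"
    by (simp add: sum_distrib_left sum.distrib sum_subtractf algebra_simps)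
  also have "\<dots> = Determinant.det M * cofactor M' i j + y $ j' * cofactor M i' j"
    using det_replace_col_unit[OF M' ij(1,2)] det_replace_col_unit[OF M' ij(3,2)]
    by (simp add: swap dup flip: det_replace_col[OF M' ij(2)])
  finally show ?thesis using ij by (simp add: yc M'_def algebra_simps)
qed

section \<open>Toeplitz determinants\<close>

text \<open>Serves to strip a bordering unit column from a minor, so that the remaining block has
  Toeplitz shape again.\<close>

lemma det_unit_col:
  fixes A :: "'a::comm_ring_1 mat"
  assumes A: "A \<in> carrier_mat n n" and ik: "i < n" "k < n"
    and unit: "\<And>r. r < n \<Longrightarrow> A $$ (r, k) = (if r = i then 1 else 0)"
  shows "Determinant.det A = cofactor A i k"
proof -
  have "A = replace_col A (unit_vec n i) k"
    using A ik by (auto simp: replace_col_def unit intro!: eq_matI)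
  then show ?thesis using det_replace_col_unit[OF A ik] by metis
qed

definition toeplitz_det :: "(complex \<Rightarrow> 'a::comm_ring_1) \<Rightarrow> nat \<Rightarrow> complex \<Rightarrow> 'a" where
  "toeplitz_det f n \<nu> = Determinant.det (Matrix.mat n n (\<lambda>(j, k). f (\<nu> - of_nat j + of_nat k)))"

text \<open>The determinant with the order in the last row lowered by one more; the value at \<open>n = 0\<close>
  is that of an empty sum of such determinants.\<close>

definition toeplitz_det_shift :: "(complex \<Rightarrow> 'a::comm_ring_1) \<Rightarrow> nat \<Rightarrow> complex \<Rightarrow> 'a" where
  "toeplitz_det_shift f n \<nu> = (if n = 0 then 0 else Determinant.det (Matrix.mat n n
     (\<lambda>(j, k). f (\<nu> - of_nat (if Suc j = n then n else j) + of_nat k))))"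

lemma toeplitz_det_0 [simp]: "toeplitz_det f 0 \<nu> = 1"
  by (simp add: toeplitz_det_def)

lemma toeplitz_det_1 [simp]: "toeplitz_det f (Suc 0) \<nu> = f \<nu>"
  by (simp add: toeplitz_det_def det_single)

lemma toeplitz_det_shift_0 [simp]: "toeplitz_det_shift f 0 \<nu> = 0"
  by (simp add: toeplitz_det_shift_def)

lemma toeplitz_det_shift_1 [simp]: "toeplitz_det_shift f (Suc 0) \<nu> = f (\<nu> - 1)"
  by (simp add: toeplitz_det_shift_def det_single)

text \<open>Jacobi's identity for the Toeplitz matrix of size \<open>n + 2\<close> and order
  \<open>\<nu> - 1\<close>, with the last two rows and the first and last columns. Deleting the
  first column raises the order by one; deleting row \<open>n\<close> but keeping row
  \<open>n + 1\<close> produces the shifted last row.\<close>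

lemma toeplitz_det_bilinear_same_size:
  fixes f :: "complex \<Rightarrow> 'a::comm_ring_1"
  shows "toeplitz_det_shift f (n + 1) \<nu> * toeplitz_det f (n + 1) (\<nu> - 1)
      - toeplitz_det f (n + 1) \<nu> * toeplitz_det_shift f (n + 1) (\<nu> - 1)
    = toeplitz_det f (n + 2) (\<nu> - 1) * toeplitz_det f n \<nu>"
proof -
  define M where "M = Matrix.mat (n + 2) (n + 2) (\<lambda>(j, k). f (\<nu> - 1 - of_nat j + of_nat k))"
  have M: "M \<in> carrier_mat (n + 2) (n + 2)" by (simp add: M_def)
  define R where "R = mat_delete (replace_col M (unit_vec (n + 2) (n + 1)) (n + 1)) n 0"
  have R: "R \<in> carrier_mat (n + 1) (n + 1)"
    by (auto simp: R_def M_def mat_delete_def replace_col_def)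
  have "Determinant.det R = cofactor R n n"
    by (rule det_unit_col[OF R]) (auto simp: R_def M_def mat_delete_def replace_col_def)
  also have "mat_delete R n n = Matrix.mat n n (\<lambda>(j, k). f (\<nu> - of_nat j + of_nat k))"
    by (rule eq_matI) (auto simp: R_def M_def mat_delete_def replace_col_def algebra_simps)
  then have "cofactor R n n = toeplitz_det f n \<nu>"
    by (simp add: cofactor_def toeplitz_det_def)
  finally have 1: "cofactor (replace_col M (unit_vec (n + 2) (n + 1)) (n + 1)) n 0 =
      (-1) ^ n * toeplitz_det f n \<nu>"
    by (simp add: cofactor_def R_def)
  have "mat_delete M n 0 =
      Matrix.mat (n + 1) (n + 1) (\<lambda>(j, k). f (\<nu> - of_nat (if Suc j = n + 1 then Suc n else j) + of_nat k))"
    by (rule eq_matI) (auto simp: M_def mat_delete_def algebra_simps)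
  then have 2: "cofactor M n 0 = (-1) ^ n * toeplitz_det_shift f (n + 1) \<nu>"
    by (simp add: cofactor_def toeplitz_det_shift_def)
  have "mat_delete M (n + 1) (n + 1) = Matrix.mat (n + 1) (n + 1) (\<lambda>(j, k). f (\<nu> - 1 - of_nat j + of_nat k))"
    by (rule eq_matI) (auto simp: M_def mat_delete_def algebra_simps)
  then have 3: "cofactor M (n + 1) (n + 1) = toeplitz_det f (n + 1) (\<nu> - 1)"
    by (simp add: cofactor_def toeplitz_det_def)
  have "mat_delete M n (n + 1) =
      Matrix.mat (n + 1) (n + 1) (\<lambda>(j, k). f (\<nu> - 1 - of_nat (if Suc j = n + 1 then Suc n else j) + of_nat k))"
    by (rule eq_matI) (auto simp: M_def mat_delete_def algebra_simps)
  then have 4: "cofactor M n (n + 1) = - toeplitz_det_shift f (n + 1) (\<nu> - 1)"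
    by (simp add: cofactor_def toeplitz_det_shift_def flip: mult_2)
  have "mat_delete M (n + 1) 0 = Matrix.mat (n + 1) (n + 1) (\<lambda>(j, k). f (\<nu> - of_nat j + of_nat k))"
    by (rule eq_matI) (auto simp: M_def mat_delete_def algebra_simps)
  then have 5: "cofactor M (n + 1) 0 = - ((-1) ^ n * toeplitz_det f (n + 1) \<nu>)"
    by (simp add: cofactor_def toeplitz_det_def)
  have 6: "Determinant.det M = toeplitz_det f (n + 2) (\<nu> - 1)"
    by (simp add: M_def toeplitz_det_def)
  have "(-1) ^ n * (toeplitz_det f (n + 2) (\<nu> - 1) * toeplitz_det f n \<nu>) =
    (-1) ^ n * (toeplitz_det_shift f (n + 1) \<nu> * toeplitz_det f (n + 1) (\<nu> - 1)
      - toeplitz_det f (n + 1) \<nu> * toeplitz_det_shift f (n + 1) (\<nu> - 1))"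
    using jacobi_adjugate_minor[OF M, of n 0 "n + 1" "n + 1"] unfolding 1 2 3 4 5 6
    by (simp add: algebra_simps)
  \<comment> \<open>The sign is removed by multiplying with it once more, since it squares to
    1.\<close>
  then have "(-1) ^ n * ((-1) ^ n * (toeplitz_det f (n + 2) (\<nu> - 1) * toeplitz_det f n \<nu>)) =
    (-1) ^ n * ((-1) ^ n * (toeplitz_det_shift f (n + 1) \<nu> * toeplitz_det f (n + 1) (\<nu> - 1)
      - toeplitz_det f (n + 1) \<nu> * toeplitz_det_shift f (n + 1) (\<nu> - 1)))"
    by simp
  then show ?thesis
    by (simp del: mult_minus1 add: mult.assoc[symmetric] power_add[symmetric] mult_2[symmetric])
qed

text \<open>Jacobi's identity for a bordered matrix, with the first and last rows and the last two
  columns. Deleting the first row lowers the order by one, and the border accounts for the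
  difference in size.\<close>

lemma toeplitz_det_bilinear_consecutive_sizes:
  fixes f :: "complex \<Rightarrow> 'a::comm_ring_1"
  shows "toeplitz_det_shift f (n + 1) \<nu> * toeplitz_det f n (\<nu> - 1)
      - toeplitz_det f (n + 1) \<nu> * toeplitz_det_shift f n (\<nu> - 1)
    = toeplitz_det f (n + 1) (\<nu> - 1) * toeplitz_det f n \<nu>"
proof (cases n)
  \<comment> \<open>The value 0 of \<open>toeplitz_det_shift\<close> at size 0 makes the subtracted
    term vanish.\<close>
  case 0
  then show ?thesis by simp
next
  case (Suc m)
  \<comment> \<open>The last column is the unit vector of row \<open>n\<close>, so the determinant
    of \<open>M\<close> omits that row and ends with the shifted row \<open>n + 1\<close>.\<close>
  define M where "M = Matrix.mat (n + 2) (n + 2)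
    (\<lambda>(r, c). if c \<le> n then f (\<nu> - of_nat r + of_nat c) else if r = n then 1 else 0)"
  have M: "M \<in> carrier_mat (n + 2) (n + 2)" by (simp add: M_def)
  note mat_simps = M_def mat_delete_def replace_col_def
  have "Determinant.det M = cofactor M n (n + 1)"
    by (rule det_unit_col[OF M]) (auto simp: M_def)
  also have "mat_delete M n (n + 1) =
      Matrix.mat (n + 1) (n + 1) (\<lambda>(j, k). f (\<nu> - of_nat (if Suc j = n + 1 then Suc n else j) + of_nat k))"
    by (rule eq_matI) (auto simp: mat_simps algebra_simps)
  then have "cofactor M n (n + 1) = - toeplitz_det_shift f (n + 1) \<nu>"
    by (simp add: cofactor_def toeplitz_det_shift_def flip: mult_2)
  finally have 1: "Determinant.det M = - toeplitz_det_shift f (n + 1) \<nu>" .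
  define R where "R = mat_delete (replace_col M (unit_vec (n + 2) (n + 1)) (n + 1)) 0 n"
  have R: "R \<in> carrier_mat (n + 1) (n + 1)"
    by (auto simp: R_def mat_simps)
  have "Determinant.det R = cofactor R n n"
    by (rule det_unit_col[OF R]) (auto simp: R_def mat_simps)
  also have "mat_delete R n n = Matrix.mat n n (\<lambda>(j, k). f (\<nu> - 1 - of_nat j + of_nat k))"
    by (rule eq_matI) (auto simp: R_def mat_simps algebra_simps)
  then have "cofactor R n n = toeplitz_det f n (\<nu> - 1)"
    by (simp add: cofactor_def toeplitz_det_def)
  finally have 2: "cofactor (replace_col M (unit_vec (n + 2) (n + 1)) (n + 1)) 0 n =
      (-1) ^ n * toeplitz_det f n (\<nu> - 1)"
    by (simp add: cofactor_def R_def)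
  define S where "S = mat_delete M 0 n"
  have S: "S \<in> carrier_mat (n + 1) (n + 1)"
    by (auto simp: S_def mat_simps)
  \<comment> \<open>Deleting row 0 has moved the unit entry from row \<open>n\<close> to row
    \<open>m = n - 1\<close>.\<close>
  have "Determinant.det S = cofactor S m n"
    by (rule det_unit_col[OF S]) (auto simp: S_def mat_simps Suc)
  also have "mat_delete S m n =
      Matrix.mat n n (\<lambda>(j, k). f (\<nu> - 1 - of_nat (if Suc j = n then Suc m else j) + of_nat k))"
    by (rule eq_matI) (auto simp: S_def mat_simps algebra_simps Suc)
  then have "cofactor S m n = - toeplitz_det_shift f n (\<nu> - 1)"
    by (simp add: cofactor_def toeplitz_det_shift_def Suc flip: mult_2)
  finally have 3: "cofactor M 0 n = - ((-1) ^ n * toeplitz_det_shift f n (\<nu> - 1))"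
    by (simp add: cofactor_def S_def)
  have "mat_delete M (n + 1) (n + 1) = Matrix.mat (n + 1) (n + 1) (\<lambda>(j, k). f (\<nu> - of_nat j + of_nat k))"
    by (rule eq_matI) (auto simp: mat_simps algebra_simps)
  then have 4: "cofactor M (n + 1) (n + 1) = toeplitz_det f (n + 1) \<nu>"
    by (simp add: cofactor_def toeplitz_det_def)
  have "mat_delete M 0 (n + 1) = Matrix.mat (n + 1) (n + 1) (\<lambda>(j, k). f (\<nu> - 1 - of_nat j + of_nat k))"
    by (rule eq_matI) (auto simp: mat_simps algebra_simps)
  then have 5: "cofactor M 0 (n + 1) = - ((-1) ^ n * toeplitz_det f (n + 1) (\<nu> - 1))"
    by (simp add: cofactor_def toeplitz_det_def)
  define T where "T = mat_delete M (n + 1) n"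
  have T: "T \<in> carrier_mat (n + 1) (n + 1)"
    by (auto simp: T_def mat_simps)
  have "Determinant.det T = cofactor T n n"
    by (rule det_unit_col[OF T]) (auto simp: T_def mat_simps)
  also have "mat_delete T n n = Matrix.mat n n (\<lambda>(j, k). f (\<nu> - of_nat j + of_nat k))"
    by (rule eq_matI) (auto simp: T_def mat_simps algebra_simps)
  then have "cofactor T n n = toeplitz_det f n \<nu>"
    by (simp add: cofactor_def toeplitz_det_def)
  finally have 6: "cofactor M (n + 1) n = - toeplitz_det f n \<nu>"
    by (simp add: cofactor_def T_def flip: mult_2)
  have "(-1) ^ n * (toeplitz_det f (n + 1) (\<nu> - 1) * toeplitz_det f n \<nu>) =
    (-1) ^ n * (toeplitz_det_shift f (n + 1) \<nu> * toeplitz_det f n (\<nu> - 1)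
      - toeplitz_det f (n + 1) \<nu> * toeplitz_det_shift f n (\<nu> - 1))"
    using jacobi_adjugate_minor[OF M, of 0 n "n + 1" "n + 1"] unfolding 1 2 3 4 5 6
    by (simp add: algebra_simps)
  then have "(-1) ^ n * ((-1) ^ n * (toeplitz_det f (n + 1) (\<nu> - 1) * toeplitz_det f n \<nu>)) =
    (-1) ^ n * ((-1) ^ n * (toeplitz_det_shift f (n + 1) \<nu> * toeplitz_det f n (\<nu> - 1)
      - toeplitz_det f (n + 1) \<nu> * toeplitz_det_shift f n (\<nu> - 1)))"
    by simp
  then show ?thesis
    by (simp del: mult_minus1 add: mult.assoc[symmetric] power_add[symmetric] mult_2[symmetric])
qed

section \<open>Derivatives and Wronskians of Toeplitz determinants\<close>

lemma permutes_less: "p permutes {0..<n::nat} \<Longrightarrow> i < n \<Longrightarrow> p i < n"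
  using permutes_in_image[of p "{0..<n}" i] by simp

lemma toeplitz_det_leibniz:
  fixes f :: "complex \<Rightarrow> 'a::comm_ring_1"
  shows "toeplitz_det f n \<nu> = (\<Sum>p | p permutes {0..<n}. signof p * (\<Prod>i<n. f (\<nu> - of_nat i + of_nat (p i))))"
proof -
  have "Determinant.det (Matrix.mat n n (\<lambda>(j, k). f (\<nu> - of_nat j + of_nat k))) =
    (\<Sum>p | p permutes {0..<n}. signof p *
      (\<Prod>i = 0..<n. Matrix.mat n n (\<lambda>(j, k). f (\<nu> - of_nat j + of_nat k)) $$ (i, p i)))"
    by (rule det_def') simp
  also have "\<dots> = (\<Sum>p | p permutes {0..<n}. signof p * (\<Prod>i<n. f (\<nu> - of_nat i + of_nat (p i))))"
    by (intro sum.cong refl arg_cong2[of _ _ _ _ "(*)"] prod.cong)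
      (auto simp: atLeast0LessThan permutes_less)
  finally show ?thesis by (simp add: toeplitz_det_def)
qed

text \<open>Negating all orders amounts to transposing the matrix. This lets facts derived from the
  lowering recurrence be reused for the raising one.\<close>

lemma toeplitz_det_reflect:
  "toeplitz_det (\<lambda>\<mu>. f (- \<mu>)) n \<nu> = toeplitz_det f n (- \<nu>)"
proof -
  have "Matrix.mat n n (\<lambda>(j, k). f (- (\<nu> - of_nat j + of_nat k))) =
      transpose_mat (Matrix.mat n n (\<lambda>(j, k). f (- \<nu> - of_nat j + of_nat k)))"
    by (rule eq_matI) (auto simp: algebra_simps)
  then show ?thesis
    using det_transpose[of "Matrix.mat n n (\<lambda>(j, k). f (- \<nu> - of_nat j + of_nat k))" n]
    by (simp add: toeplitz_det_def)
qed

text \<open>Lowering the order in a row makes it equal to the next row, unless it is the last one.\<close>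

lemma has_field_derivative_toeplitz_det:
  fixes f :: "complex \<Rightarrow> complex \<Rightarrow> complex"
  assumes f: "\<And>\<mu>. (f \<mu> has_field_derivative c * f (\<mu> - 1) x - \<mu> / x * f \<mu> x) (at x)"
  shows "((\<lambda>y. toeplitz_det (\<lambda>\<mu>. f \<mu> y) n \<nu>) has_field_derivative
      c * toeplitz_det_shift (\<lambda>\<mu>. f \<mu> x) n \<nu> - of_nat n * \<nu> / x * toeplitz_det (\<lambda>\<mu>. f \<mu> x) n \<nu>) (at x)"
proof -
  define h where "h p i = f (\<nu> - of_nat i + of_nat (p i)) x" for p :: "nat \<Rightarrow> nat" and i
  define h' where "h' p i = f (\<nu> - of_nat (Suc i) + of_nat (p i)) x" for p :: "nat \<Rightarrow> nat" and i
  define B where "B i = Matrix.mat n n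
    (\<lambda>(j, k). f (\<nu> - of_nat (if j = i then Suc i else j) + of_nat k) x)" for i
  let ?P = "{p. p permutes {0..<n}}"
  have detB: "Determinant.det (B i) = (\<Sum>p\<in>?P. signof p * (h' p i * (\<Prod>j\<in>{..<n}-{i}. h p j)))"
    if i: "i < n" for i
  proof -
    have "Determinant.det (B i) = (\<Sum>p\<in>?P. signof p * (\<Prod>j = 0..<n. B i $$ (j, p j)))"
      by (rule det_def') (simp add: B_def)
    also have "(\<Prod>j = 0..<n. B i $$ (j, p j)) = h' p i * (\<Prod>j\<in>{..<n}-{i}. h p j)" if "p \<in> ?P" for p
    proof -
      have "(\<Prod>j = 0..<n. B i $$ (j, p j)) = B i $$ (i, p i) * (\<Prod>j\<in>{..<n}-{i}. B i $$ (j, p j))"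
        using i by (subst prod.remove[of _ i]) (auto simp: atLeast0LessThan)
      also have "(\<Prod>j\<in>{..<n}-{i}. B i $$ (j, p j)) = (\<Prod>j\<in>{..<n}-{i}. h p j)"
        using that by (intro prod.cong) (auto simp: B_def h_def permutes_less)
      also have "B i $$ (i, p i) = h' p i"
        using that i by (auto simp: B_def h'_def permutes_less)
      finally show ?thesis .
    qed
    then have "(\<Sum>p\<in>?P. signof p * (\<Prod>j = 0..<n. B i $$ (j, p j))) =
        (\<Sum>p\<in>?P. signof p * (h' p i * (\<Prod>j\<in>{..<n}-{i}. h p j)))"
      by (intro sum.cong) auto
    finally show ?thesis .
  qed
  have B0: "Determinant.det (B i) = 0" if "Suc i < n" for i
    using that by (intro det_identical_rows[of "B i" n i "Suc i"]) (auto simp: B_def)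
  have sumB: "(\<Sum>i<n. Determinant.det (B i)) = toeplitz_det_shift (\<lambda>\<mu>. f \<mu> x) n \<nu>"
  proof (cases n)
    case (Suc m)
    have "(\<Sum>i<n. Determinant.det (B i)) = Determinant.det (B m)"
      using B0 by (simp add: Suc)
    also have "B m = Matrix.mat n n (\<lambda>(j, k). f (\<nu> - of_nat (if Suc j = n then Suc m else j) + of_nat k) x)"
      by (rule eq_matI) (auto simp: B_def Suc)
    finally show ?thesis by (simp add: toeplitz_det_shift_def Suc)
  qed simp
  \<comment> \<open>The offsets \<open>- i\<close> and \<open>p i\<close> cancel over a permutation,
    so every Leibniz term has the same total order and the diagonal contributions add up to a
    multiple of the determinant.\<close>
  have weight: "(\<Sum>i<n. \<nu> - of_nat i + of_nat (p i)) = of_nat n * \<nu>" if "p \<in> ?P" for p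
  proof -
    have "(\<Sum>i<n. complex_of_nat (p i)) = (\<Sum>i<n. of_nat i)"
      using sum.permute[of p "{0..<n}" "\<lambda>i. complex_of_nat i"] that
      unfolding atLeast0LessThan o_def mem_Collect_eq by metis
    then show ?thesis by (simp add: sum.distrib sum_subtractf)
  qed
  have h_deriv: "(f (\<nu> - of_nat i + of_nat (p i)) has_field_derivative
      c * h' p i - (\<nu> - of_nat i + of_nat (p i)) / x * h p i) (at x)" for p i
  proof -
    have "\<nu> - of_nat (Suc i) + of_nat (p i) = \<nu> - of_nat i + of_nat (p i) - 1" by simp
    then show ?thesis unfolding h_def h'_def using f by metis
  qed
  have "((\<lambda>y. toeplitz_det (\<lambda>\<mu>. f \<mu> y) n \<nu>) has_field_derivative
      (\<Sum>p\<in>?P. signof p * (\<Sum>i<n. (c * h' p i - (\<nu> - of_nat i + of_nat (p i)) / x * h p i) *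
        (\<Prod>j\<in>{..<n}-{i}. h p j)))) (at x)"
  proof -
    have "((\<lambda>y. \<Prod>i<n. f (\<nu> - of_nat i + of_nat (p i)) y) has_field_derivative
        (\<Sum>i<n. (c * h' p i - (\<nu> - of_nat i + of_nat (p i)) / x * h p i) *
          (\<Prod>j\<in>{..<n}-{i}. h p j))) (at x)" for p
      using has_field_derivative_prod[of "{..<n}" "\<lambda>i. f (\<nu> - of_nat i + of_nat (p i))",
        OF h_deriv[of _ p]]
      by (simp add: h_def[abs_def])
    then show ?thesis
      unfolding toeplitz_det_leibniz by (intro DERIV_sum DERIV_cmult)
  qed
  also have "(\<Sum>p\<in>?P. signof p * (\<Sum>i<n. (c * h' p i - (\<nu> - of_nat i + of_nat (p i)) / x * h p i) *
        (\<Prod>j\<in>{..<n}-{i}. h p j))) =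
      (\<Sum>p\<in>?P. (\<Sum>i<n. c * (signof p * (h' p i * (\<Prod>j\<in>{..<n}-{i}. h p j)))) -
         of_nat n * \<nu> / x * (signof p * (\<Prod>j<n. h p j)))"
  proof (intro sum.cong refl)
    fix p assume p: "p \<in> ?P"
    have rem: "(\<Prod>j<n. h p j) = h p i * (\<Prod>j\<in>{..<n}-{i}. h p j)" if "i < n" for i
      using that by (intro prod.remove) auto
    have "(\<Sum>i<n. (c * h' p i - (\<nu> - of_nat i + of_nat (p i)) / x * h p i) * (\<Prod>j\<in>{..<n}-{i}. h p j)) =
      (\<Sum>i<n. c * (h' p i * (\<Prod>j\<in>{..<n}-{i}. h p j)) -
         (\<nu> - of_nat i + of_nat (p i)) * ((\<Prod>j<n. h p j) / x))"
      by (intro sum.cong refl) (simp add: rem algebra_simps)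
    also have "\<dots> = (\<Sum>i<n. c * (h' p i * (\<Prod>j\<in>{..<n}-{i}. h p j))) - of_nat n * \<nu> * ((\<Prod>j<n. h p j) / x)"
      by (simp only: sum_subtractf weight[OF p] flip: sum_distrib_right)
    finally have "signof p * (\<Sum>i<n. (c * h' p i - (\<nu> - of_nat i + of_nat (p i)) / x * h p i) *
        (\<Prod>j\<in>{..<n}-{i}. h p j)) = signof p * ((\<Sum>i<n. c * (h' p i * (\<Prod>j\<in>{..<n}-{i}. h p j))) -
          of_nat n * \<nu> * ((\<Prod>j<n. h p j) / x))"
      by (simp only:)
    also have "\<dots> = (\<Sum>i<n. c * (signof p * (h' p i * (\<Prod>j\<in>{..<n}-{i}. h p j)))) -
         of_nat n * \<nu> / x * (signof p * (\<Prod>j<n. h p j))"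
      by (simp add: right_diff_distrib sum_distrib_left mult_ac)
    finally show "signof p * (\<Sum>i<n. (c * h' p i - (\<nu> - of_nat i + of_nat (p i)) / x * h p i) *
        (\<Prod>j\<in>{..<n}-{i}. h p j)) =
      (\<Sum>i<n. c * (signof p * (h' p i * (\<Prod>j\<in>{..<n}-{i}. h p j)))) -
         of_nat n * \<nu> / x * (signof p * (\<Prod>j<n. h p j))" .
  qed
  also have "\<dots> = c * (\<Sum>i<n. Determinant.det (B i)) - of_nat n * \<nu> / x * toeplitz_det (\<lambda>\<mu>. f \<mu> x) n \<nu>"
  proof -
    have "(\<Sum>i<n. Determinant.det (B i)) =
        (\<Sum>p\<in>?P. \<Sum>i<n. signof p * (h' p i * (\<Prod>j\<in>{..<n}-{i}. h p j)))"
      by (subst sum.swap) (simp add: detB)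
    then show ?thesis
      by (simp add: sum_subtractf sum_distrib_left toeplitz_det_leibniz h_def)
  qed
  finally show ?thesis by (simp add: sumB)
qed

text \<open>The coefficient is \<open>(n + 1) * \<nu> - n * (\<nu> - 1) = \<nu> + n\<close>. The
  constant \<open>c\<close> will be 1 for the lowering recurrence and -1 for the reflected raising
  one.\<close>

lemma wronskian_toeplitz_det_consecutive_sizes:
  fixes f :: "complex \<Rightarrow> complex \<Rightarrow> complex"
  assumes f: "\<And>\<mu>. (f \<mu> has_field_derivative c * f (\<mu> - 1) x - \<mu> / x * f \<mu> x) (at x)"
  defines "T \<equiv> \<lambda>n \<nu> y. toeplitz_det (\<lambda>\<mu>. f \<mu> y) n \<nu>"
  shows "deriv (T (n + 1) \<nu>) x * T n (\<nu> - 1) x - T (n + 1) \<nu> x * deriv (T n (\<nu> - 1)) x =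
    c * (T (n + 1) (\<nu> - 1) x * T n \<nu> x) - (\<nu> + of_nat n) / x * (T (n + 1) \<nu> x * T n (\<nu> - 1) x)"
proof -
  let ?s = "\<lambda>n \<nu>. toeplitz_det_shift (\<lambda>\<mu>. f \<mu> x) n \<nu>"
  have d: "deriv (T n \<nu>) x = c * ?s n \<nu> - of_nat n * \<nu> / x * T n \<nu> x" for n \<nu>
    unfolding T_def by (intro DERIV_imp_deriv has_field_derivative_toeplitz_det f)
  have "deriv (T (n + 1) \<nu>) x * T n (\<nu> - 1) x - T (n + 1) \<nu> x * deriv (T n (\<nu> - 1)) x =
    c * (?s (n + 1) \<nu> * T n (\<nu> - 1) x - T (n + 1) \<nu> x * ?s n (\<nu> - 1)) -
    (\<nu> + of_nat n) / x * (T (n + 1) \<nu> x * T n (\<nu> - 1) x)"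
    unfolding d by (simp add: algebra_simps add_divide_distrib diff_divide_distrib)
  then show ?thesis
    by (simp only: T_def toeplitz_det_bilinear_consecutive_sizes)
qed

lemma wronskian_toeplitz_det_same_size:
  fixes f :: "complex \<Rightarrow> complex \<Rightarrow> complex"
  assumes f: "\<And>\<mu>. (f \<mu> has_field_derivative c * f (\<mu> - 1) x - \<mu> / x * f \<mu> x) (at x)"
  defines "T \<equiv> \<lambda>n \<nu> y. toeplitz_det (\<lambda>\<mu>. f \<mu> y) n \<nu>"
  shows "deriv (T (n + 1) \<nu>) x * T (n + 1) (\<nu> - 1) x - T (n + 1) \<nu> x * deriv (T (n + 1) (\<nu> - 1)) x =
    c * (T (n + 2) (\<nu> - 1) x * T n \<nu> x) - (of_nat n + 1) / x * (T (n + 1) \<nu> x * T (n + 1) (\<nu> - 1) x)"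
proof -
  let ?s = "\<lambda>n \<nu>. toeplitz_det_shift (\<lambda>\<mu>. f \<mu> x) n \<nu>"
  have d: "deriv (T n \<nu>) x = c * ?s n \<nu> - of_nat n * \<nu> / x * T n \<nu> x" for n \<nu>
    unfolding T_def by (intro DERIV_imp_deriv has_field_derivative_toeplitz_det f)
  have "deriv (T (n + 1) \<nu>) x * T (n + 1) (\<nu> - 1) x - T (n + 1) \<nu> x * deriv (T (n + 1) (\<nu> - 1)) x =
    c * (?s (n + 1) \<nu> * T (n + 1) (\<nu> - 1) x - T (n + 1) \<nu> x * ?s (n + 1) (\<nu> - 1)) -
    (of_nat n + 1) / x * (T (n + 1) \<nu> x * T (n + 1) (\<nu> - 1) x)"
    unfolding d by (simp add: algebra_simps add_divide_distrib diff_divide_distrib)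
  then show ?thesis
    by (simp only: T_def toeplitz_det_bilinear_same_size)
qed

text \<open>The first equation is affine in \<open>P\<close> with a nonzero coefficient, so it gives
  \<open>u P\<close> in terms of \<open>u\<close> and its derivative; inserting this after one more
  differentiation leaves an equation in \<open>u\<close> alone. The system is required on an open
  set because \<open>u\<close> is differentiated twice.\<close>

lemma painleve_III_of_first_order_system:
  fixes u P :: "complex \<Rightarrow> complex" and \<nu> m :: complex
  assumes U: "open U" "x \<in> U" "0 \<notin> U"
    and nz: "\<And>y. y \<in> U \<Longrightarrow> u y \<noteq> 0"
    and u: "\<And>y. y \<in> U \<Longrightarrow> (u has_field_derivative
      - (u y)\<^sup>2 - 1 - (2 * \<nu> - 1) * u y / y - 2 * u y * P y / y) (at y)"
    and P: "\<And>y. y \<in> U \<Longrightarrow> (P has_field_derivative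
      (P y - m - 1) * u y - (P y + m + 1) / u y) (at y)"
  shows "deriv (deriv u) x = (deriv u x)\<^sup>2 / u x - deriv u x / x
    + ((2 * \<nu> + 2 * m) * (u x)\<^sup>2 + (- (2 * \<nu>) + 2 + 2 * m)) / x + (u x) ^ 3 - 1 / u x"
proof -
  have du: "deriv u y = - (u y)\<^sup>2 - 1 - (2 * \<nu> - 1) * u y / y - 2 * u y * P y / y" if "y \<in> U" for y
    using u[OF that] by (rule DERIV_imp_deriv)
  have x: "x \<noteq> 0" "u x \<noteq> 0" using U nz by auto
  define u1 where "u1 = deriv u x"
  define P1 where "P1 = (P x - m - 1) * u x - (P x + m + 1) / u x"
  have ux: "(u has_field_derivative u1) (at x)" and Px: "(P has_field_derivative P1) (at x)"
    using u[OF U(2)] du[OF U(2)] P[OF U(2)] by (simp_all add: u1_def P1_def)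
  have "((\<lambda>y. - (u y)\<^sup>2 - 1 - (2 * \<nu> - 1) * u y / y - 2 * u y * P y / y) has_field_derivative
      - 2 * u x * u1 - (2 * \<nu> - 1) * (u1 * x - u x) / x\<^sup>2
      - 2 * ((u1 * P x + u x * P1) * x - u x * P x) / x\<^sup>2) (at x)"
    using x by (auto intro!: derivative_eq_intros ux Px simp: field_simps power2_eq_square)
  then have "(deriv u has_field_derivative
      - 2 * u x * u1 - (2 * \<nu> - 1) * (u1 * x - u x) / x\<^sup>2
      - 2 * ((u1 * P x + u x * P1) * x - u x * P x) / x\<^sup>2) (at x)"
    by (rule has_field_derivative_transform_within_open[OF _ U(1,2)]) (simp add: du)
  then have dd: "deriv (deriv u) x = - 2 * u x * u1 - (2 * \<nu> - 1) * (u1 * x - u x) / x\<^sup>2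
      - 2 * ((u1 * P x + u x * P1) * x - u x * P x) / x\<^sup>2"
    by (rule DERIV_imp_deriv)
  \<comment> \<open>After multiplication by \<open>u x\<close>, the second derivative contains
    \<open>P\<close> only through this product.\<close>
  define Z where "Z = 2 * u x * P x"
  have "x * u1 = - x * (u x)\<^sup>2 - x - (2 * \<nu> - 1) * u x - 2 * u x * P x"
    unfolding u1_def du[OF U(2)] using x by (simp add: right_diff_distrib)
  then have Z: "Z = - (x * (u1 + (u x)\<^sup>2 + 1) + (2 * \<nu> - 1) * u x)"
    by (simp add: Z_def algebra_simps)
  have P1: "2 * u x * (u x * P1) =
      Z * (u x)\<^sup>2 - 2 * (m + 1) * (u x) ^ 3 - Z - 2 * (m + 1) * u x"
    using x by (simp add: P1_def Z_def field_simps power2_eq_square power3_eq_cube)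
  have "u x * x\<^sup>2 * deriv (deriv u) x = - 2 * (u x)\<^sup>2 * u1 * x\<^sup>2 -
      (2 * \<nu> - 1) * (u1 * x - u x) * u x - u1 * x * Z - x * (2 * u x * (u x * P1)) + u x * Z"
    unfolding dd using x by (simp add: Z_def field_simps power2_eq_square)
  also have "\<dots> = x\<^sup>2 * u1\<^sup>2 - x * u x * u1 +
      x * u x * ((2 * \<nu> + 2 * m) * (u x)\<^sup>2 + (- (2 * \<nu>) + 2 + 2 * m)) + x\<^sup>2 * (u x) ^ 4 - x\<^sup>2"
    unfolding P1 Z by (simp add: algebra_simps power2_eq_square power3_eq_cube power4_eq_xxxx)
  also have "\<dots> = u x * x\<^sup>2 * (u1\<^sup>2 / u x - u1 / x
    + ((2 * \<nu> + 2 * m) * (u x)\<^sup>2 + (- (2 * \<nu>) + 2 + 2 * m)) / x + (u x) ^ 3 - 1 / u x)"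
    using x by (simp add: field_simps power2_eq_square power3_eq_cube power4_eq_xxxx)
  finally show ?thesis
    using x by (simp add: u1_def)
qed

section \<open>Painleve III from the recurrences of a family of cylinder functions\<close>

text \<open>Abstracts from the Bessel functions so that the limits hidden in \<open>Bessel_Y\<close>
  stay out of the determinant calculus.\<close>

locale cylinder_family =
  fixes f :: "complex \<Rightarrow> complex \<Rightarrow> complex" and S :: "complex set"
  assumes open_S: "open S" and connected_S: "connected S" and zero_notin_S: "0 \<notin> S"
    and lower: "x \<in> S \<Longrightarrow> (f \<nu> has_field_derivative f (\<nu> - 1) x - \<nu> / x * f \<nu> x) (at x)"
    and raise: "x \<in> S \<Longrightarrow> (f \<nu> has_field_derivative \<nu> / x * f \<nu> x - f (\<nu> + 1) x) (at x)"
    and not_identically_zero: "\<exists>x\<in>S. f \<nu> x \<noteq> 0"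
begin

definition D :: "nat \<Rightarrow> complex \<Rightarrow> complex \<Rightarrow> complex" where
  "D n \<nu> x = toeplitz_det (\<lambda>\<mu>. f \<mu> x) n \<nu>"

lemma D_0 [simp]: "D 0 \<nu> x = 1" and D_1 [simp]: "D (Suc 0) \<nu> x = f \<nu> x"
  by (simp_all add: D_def)

lemma D_holomorphic: "D n \<nu> holomorphic_on S"
proof -
  have "D n \<nu> field_differentiable (at x)" if "x \<in> S" for x
    using has_field_derivative_toeplitz_det[of f 1 x n \<nu>] lower[OF that]
    unfolding field_differentiable_def D_def[abs_def] by auto
  then show ?thesis
    by (auto simp: holomorphic_on_def intro: field_differentiable_at_within)
qed

lemma has_field_derivative_D: "x \<in> S \<Longrightarrow> (D n \<nu> has_field_derivative deriv (D n \<nu>) x) (at x)"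
  using D_holomorphic open_S by (rule holomorphic_derivI)

lemma lower_as_row_shift: "x \<in> S \<Longrightarrow> (f \<nu> has_field_derivative 1 * f (\<nu> - 1) x - \<nu> / x * f \<nu> x) (at x)"
  using lower by simp

text \<open>In the family with negated orders raising becomes lowering with factor -1, so the
  Wronskian lemmas apply a second time.\<close>

lemma raise_reflected: "x \<in> S \<Longrightarrow>
  (f (- \<nu>) has_field_derivative - 1 * f (- (\<nu> - 1)) x - \<nu> / x * f (- \<nu>) x) (at x)"
  by (rule DERIV_cong[OF raise]) simp_all

lemma toeplitz_det_reflected_family: "toeplitz_det (\<lambda>\<mu>. f (- \<mu>) y) n \<nu> = D n (- \<nu>) y"
  using toeplitz_det_reflect[of "\<lambda>\<mu>. f \<mu> y"] by (simp add: D_def)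

lemma wronskian_D_consecutive_sizes:
  assumes "x \<in> S"
  shows "deriv (D (n + 1) \<nu>) x * D n (\<nu> - 1) x - D (n + 1) \<nu> x * deriv (D n (\<nu> - 1)) x =
    D (n + 1) (\<nu> - 1) x * D n \<nu> x - (\<nu> + of_nat n) / x * (D (n + 1) \<nu> x * D n (\<nu> - 1) x)"
  using wronskian_toeplitz_det_consecutive_sizes[OF lower_as_row_shift[OF assms]]
  unfolding D_def[symmetric, abs_def] by simp

text \<open>The order \<open>1 - \<nu>\<close> is chosen because reflection takes it and its
  predecessor \<open>- \<nu>\<close> to \<open>\<nu> - 1\<close> and \<open>\<nu>\<close>.\<close>

lemma wronskian_D_consecutive_sizes':
  assumes "x \<in> S"
  shows "deriv (D (n + 1) (\<nu> - 1)) x * D n \<nu> x - D (n + 1) (\<nu> - 1) x * deriv (D n \<nu>) x =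
    (\<nu> - 1 - of_nat n) / x * (D (n + 1) (\<nu> - 1) x * D n \<nu> x) - D (n + 1) \<nu> x * D n (\<nu> - 1) x"
  using wronskian_toeplitz_det_consecutive_sizes[OF raise_reflected[OF assms], of n "1 - \<nu>"]
  unfolding toeplitz_det_reflected_family
  by (simp add: algebra_simps add_divide_distrib diff_divide_distrib)

lemma wronskian_D_same_size:
  assumes "x \<in> S"
  shows "deriv (D (n + 1) \<nu>) x * D (n + 1) (\<nu> - 1) x - D (n + 1) \<nu> x * deriv (D (n + 1) (\<nu> - 1)) x =
    D (n + 2) (\<nu> - 1) x * D n \<nu> x - (of_nat n + 1) / x * (D (n + 1) \<nu> x * D (n + 1) (\<nu> - 1) x)"
  using wronskian_toeplitz_det_same_size[OF lower_as_row_shift[OF assms]]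
  unfolding D_def[symmetric, abs_def] by simp

text \<open>The left side is that of \<open>wronskian_D_same_size\<close>; equating the right sides
  gives a derivative-free relation between the sizes \<open>n\<close>, \<open>n + 1\<close> and
  \<open>n + 2\<close>.\<close>

lemma wronskian_D_same_size':
  assumes "x \<in> S"
  shows "deriv (D (n + 1) \<nu>) x * D (n + 1) (\<nu> - 1) x - D (n + 1) \<nu> x * deriv (D (n + 1) (\<nu> - 1)) x =
    D (n + 2) \<nu> x * D n (\<nu> - 1) x + (of_nat n + 1) / x * (D (n + 1) \<nu> x * D (n + 1) (\<nu> - 1) x)"
  using wronskian_toeplitz_det_same_size[OF raise_reflected[OF assms], of n "1 - \<nu>"]
  unfolding toeplitz_det_reflected_family
  by (simp add: algebra_simps add_divide_distrib diff_divide_distrib)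

section \<open>Generic nonvanishing of the determinants\<close>

lemma eventually_nonzero:
  assumes "g holomorphic_on S" "\<exists>x\<in>S. g x \<noteq> 0"
  shows "\<forall>\<^sub>\<approx>x\<in>S. g x \<noteq> 0"
  unfolding eventually_cosparse_open_eq[OF open_S]
proof
  fix z assume z: "z \<in> S"
  obtain \<beta> where "\<beta> \<in> S" "g \<beta> \<noteq> 0" using assms(2) by blast
  then have "\<forall>\<^sub>F x in at z. g x \<noteq> 0 \<and> x \<in> S"
    by (rule non_zero_neighbour_alt[OF assms(1) open_S connected_S z])
  then show "\<forall>\<^sub>F x in at z. g x \<noteq> 0"
    by (rule eventually_mono) auto
qed

lemma S_nonempty: "S \<noteq> {}"
  using not_identically_zero by auto

text \<open>Holomorphic functions on a connected open set have no zero divisors: two sparse zero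
  sets cannot cover it.\<close>

lemma D_mult_not_identically_zero:
  assumes "\<exists>x\<in>S. D m \<mu> x \<noteq> 0" "\<exists>x\<in>S. D n \<nu> x \<noteq> 0"
  shows "\<exists>x\<in>S. D m \<mu> x * D n \<nu> x \<noteq> 0"
proof -
  have "\<forall>\<^sub>\<approx>x\<in>S. x \<in> S \<and> D m \<mu> x * D n \<nu> x \<noteq> 0"
    using eventually_nonzero[OF D_holomorphic assms(1)] eventually_nonzero[OF D_holomorphic assms(2)]
      eventually_in_cosparse[OF subset_refl open_S]
    by eventually_elim simp
  from eventually_happens[OF this] show ?thesis using S_nonempty by auto
qed

text \<open>If \<open>D (n + 1) \<nu>\<close> vanished identically then so would \<open>D (n + 1) (\<nu> - 1)\<close>, and the two
  expressions for the Wronskian of \<open>D n \<nu>\<close> and \<open>D n (\<nu> - 1)\<close> would differ by a nonzero multiple of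
  their product.\<close>

lemma D_not_identically_zero: "\<exists>x\<in>S. D n \<nu> x \<noteq> 0"
proof (induction n arbitrary: \<nu>)
  case 0
  then show ?case using S_nonempty by auto
next
  case (Suc n)
  show ?case
  proof (cases n)
    case 0
    then show ?thesis using not_identically_zero by simp
  next
    case (Suc m)
    show ?thesis
    proof (rule ccontr)
      assume "\<not> ?thesis"
      then have C: "D (Suc n) \<nu> x = 0" if "x \<in> S" for x using that by auto
      have dC: "deriv (D (Suc n) \<nu>) x = 0" if "x \<in> S" for x
      proof (rule DERIV_imp_deriv)
        show "(D (Suc n) \<nu> has_field_derivative 0) (at x)"
          by (rule has_field_derivative_transform_within_open[OF DERIV_const[of 0] open_S that])
            (simp add: C)
      qed
      \<comment> \<open>With \<open>D (Suc n) \<nu>\<close> and its derivative zero, this product is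
        the only term left in the Wronskian identity.\<close>
      have AB: "D (Suc n) (\<nu> - 1) x * D n \<nu> x = 0" if "x \<in> S" for x
        using wronskian_D_consecutive_sizes[OF that, of n \<nu>] that by (simp add: C dC)
      then have "\<not> (\<exists>x\<in>S. D (Suc n) (\<nu> - 1) x \<noteq> 0)"
        using D_mult_not_identically_zero Suc.IH by meson
      then have A: "D (Suc n) (\<nu> - 1) x = 0" if "x \<in> S" for x using that by auto
      have "D n \<nu> x * D n (\<nu> - 1) x = 0" if x: "x \<in> S" for x
      proof -
        have "2 * ((of_nat m + 1) / x * (D n \<nu> x * D n (\<nu> - 1) x)) = 0"
          using wronskian_D_same_size[OF x, of m \<nu>] wronskian_D_same_size'[OF x, of m \<nu>] A[OF x] C[OF x]
          by (simp add: Suc)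
        moreover have "x \<noteq> 0" "of_nat m + 1 \<noteq> (0 :: complex)"
          using x zero_notin_S of_nat_neq_0[of m] by (auto simp: add.commute)
        ultimately show ?thesis by auto
      qed
      then show False using D_mult_not_identically_zero Suc.IH by meson
    qed
  qed
qed

section \<open>Painleve III for the quotient of determinants\<close>

definition u :: "nat \<Rightarrow> complex \<Rightarrow> complex \<Rightarrow> complex" where
  "u n \<nu> x = - (D (n + 1) (\<nu> - 1) x * D n \<nu> x) / (D (n + 1) \<nu> x * D n (\<nu> - 1) x)"

lemma painleve_III_at:
  assumes x: "x \<in> S" and nz: "D (n + 1) (\<nu> - 1) x \<noteq> 0" "D n \<nu> x \<noteq> 0" "D (n + 1) \<nu> x \<noteq> 0" "D n (\<nu> - 1) x \<noteq> 0"
  shows "deriv (deriv (u n \<nu>)) x = (deriv (u n \<nu>) x)\<^sup>2 / u n \<nu> x - deriv (u n \<nu>) x / x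
    + ((2 * \<nu> + 2 * of_nat n) * (u n \<nu> x)\<^sup>2 + (- (2 * \<nu>) + 2 + 2 * of_nat n)) / x
    + (u n \<nu> x) ^ 3 - 1 / u n \<nu> x"
proof -
  define A B C E F G where ABC: "A = D (n + 1) (\<nu> - 1)" "B = D n \<nu>" "C = D (n + 1) \<nu>"
    "E = D n (\<nu> - 1)" "F = D (n + 2) (\<nu> - 1)" "G = D (n + 2) \<nu>"
  define m where "m = complex_of_nat n"
  define w where "w = u n \<nu>"
  \<comment> \<open>By \<open>CA\<close> below this is \<open>y\<close> times the logarithmic
    derivative of \<open>C / A\<close>, in a derivative-free form that the known Wronskians can
    differentiate again.\<close>
  define P where "P y = y * (F y / C y * (B y / A y)) - m - 1" for y
  define U where "U = {y \<in> S. A y * B y * C y * E y \<noteq> 0}"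
  have hol: "A holomorphic_on S" "B holomorphic_on S" "C holomorphic_on S" "E holomorphic_on S"
    unfolding ABC by (rule D_holomorphic)+
  have w: "w y = - (A y * B y) / (C y * E y)" for y
    by (simp add: w_def u_def ABC)
  have "continuous_on S (\<lambda>y. A y * B y * C y * E y)"
    by (intro holomorphic_on_imp_continuous_on holomorphic_intros hol)
  then have "open (S \<inter> (\<lambda>y. A y * B y * C y * E y) -` (- {0}))"
    by (rule continuous_open_preimage) (use open_S in auto)
  also have "S \<inter> (\<lambda>y. A y * B y * C y * E y) -` (- {0}) = U"
    by (auto simp: U_def)
  finally have "open U" .
  have y: "y \<in> S" "y \<noteq> 0" "A y \<noteq> 0" "B y \<noteq> 0" "C y \<noteq> 0" "E y \<noteq> 0" if "y \<in> U" for y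
    using that zero_notin_S by (auto simp: U_def)
  have der: "(A has_field_derivative deriv A y) (at y)" "(B has_field_derivative deriv B y) (at y)"
    "(C has_field_derivative deriv C y) (at y)" "(E has_field_derivative deriv E y) (at y)"
    "(F has_field_derivative deriv F y) (at y)"
    if "y \<in> U" for y
    unfolding ABC using y(1)[OF that] by (rule has_field_derivative_D)+
  have CE: "deriv C y * E y - C y * deriv E y = A y * B y - (\<nu> + m) / y * (C y * E y)" 
    and AB: "deriv A y * B y - A y * deriv B y = (\<nu> - 1 - m) / y * (A y * B y) - C y * E y"
    and FC: "deriv F y * C y - F y * deriv C y = (\<nu> - 2 - m) / y * (F y * C y) - G y * A y"
    and CA: "deriv C y * A y - C y * deriv A y = F y * B y - (m + 1) / y * (C y * A y)"
    and CA': "deriv C y * A y - C y * deriv A y = G y * E y + (m + 1) / y * (C y * A y)"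
    if "y \<in> U" for y
    using wronskian_D_consecutive_sizes[OF y(1)[OF that], of n \<nu>] wronskian_D_consecutive_sizes'[OF y(1)[OF that], of n \<nu>]
      wronskian_D_consecutive_sizes'[OF y(1)[OF that], of "n + 1" \<nu>] wronskian_D_same_size[OF y(1)[OF that], of n \<nu>]
      wronskian_D_same_size'[OF y(1)[OF that], of n \<nu>]
    unfolding ABC m_def by (simp_all add: algebra_simps)
  \<comment> \<open>Comparing the two forms of the same-size Wronskian trades \<open>F B\<close> for
    \<open>G E\<close>; the difference \<open>2 * (m + 1)\<close> turns \<open>- m - 1\<close> into
    \<open>m + 1\<close>.\<close>
  have P': "P y = y * (G y / C y * (E y / A y)) + m + 1" if "y \<in> U" for y
  proof -
    define q where "q = (m + 1) / y * (C y * A y)"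
    have "F y * B y = G y * E y + 2 * q"
      using trans[OF CA[OF that, symmetric] CA'[OF that], folded q_def] by (simp add: algebra_simps)
    then have "y * (F y * B y) = y * (G y * E y) + 2 * ((m + 1) * (C y * A y))"
      using y[OF that] by (simp add: q_def distrib_left)
    then have "y * (F y * B y) / (C y * A y) = y * (G y * E y) / (C y * A y) + 2 * (m + 1)"
      using y[OF that] by (simp add: add_divide_distrib)
    then show ?thesis by (simp add: P_def)
  qed
  have "(w has_field_derivative - (w y)\<^sup>2 - 1 - (2 * \<nu> - 1) * w y / y - 2 * w y * P y / y) (at y)"
    if yU: "y \<in> U" for y
  proof -
    note [simp] = y[OF yU]
    define a b c e where l: "a = deriv A y / A y" "b = deriv B y / B y" "c = deriv C y / C y"
      "e = deriv E y / E y"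
    have quot: "p / q - r / s = (p * s - q * r) / (q * s)" if "q \<noteq> 0" "s \<noteq> 0" for p q r s :: complex
      using that by (simp add: divide_simps)
    have "c - e = (A y * B y - (\<nu> + m) / y * (C y * E y)) / (C y * E y)"
      unfolding l CE[OF yU, symmetric] by (rule quot) auto
    then have ce: "c - e = - w y - (\<nu> + m) / y"
      by (simp add: w diff_divide_distrib)
    have "a - b = ((\<nu> - 1 - m) / y * (A y * B y) - C y * E y) / (A y * B y)"
      unfolding l AB[OF yU, symmetric] by (rule quot) auto
    then have ab: "a - b = 1 / w y + (\<nu> - 1 - m) / y"
      by (simp add: w diff_divide_distrib)
    have "c - a = (F y * B y - (m + 1) / y * (C y * A y)) / (C y * A y)"
      unfolding l CA[OF yU, symmetric] by (rule quot) auto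
    then have ca: "c - a = P y / y"
      by (simp add: P_def diff_divide_distrib add_divide_distrib)
    \<comment> \<open>The logarithmic derivative of \<open>w\<close> is regrouped into the three
      differences that the Wronskians evaluate.\<close>
    have "a + b - c - e = (c - e) - (a - b) - 2 * (c - a)"
      by simp
    then have log_deriv: "a + b - c - e = - w y - 1 / w y - (2 * \<nu> - 1) / y - 2 * P y / y"
      unfolding ce ab ca by (simp add: add_divide_distrib diff_divide_distrib)
    have "(w has_field_derivative w y * (a + b - c - e)) (at y)"
      unfolding w[abs_def] by (auto intro!: derivative_eq_intros der[OF yU] simp: l field_simps)
    moreover have "w y * (a + b - c - e) =
        - (w y)\<^sup>2 - 1 - (2 * \<nu> - 1) * w y / y - 2 * w y * P y / y"
      unfolding log_deriv by (simp add: w field_simps power2_eq_square)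
    ultimately show ?thesis by simp
  qed
  moreover have "(P has_field_derivative (P y - m - 1) * w y - (P y + m + 1) / w y) (at y)"
    if yU: "y \<in> U" for y
  proof -
    note [simp] = y[OF yU]
    have "(P has_field_derivative F y / C y * (B y / A y) +
        y * ((deriv F y * C y - F y * deriv C y) / (C y)\<^sup>2 * (B y / A y)
          - F y / C y * ((deriv A y * B y - A y * deriv B y) / (A y)\<^sup>2))) (at y)"
      unfolding P_def[abs_def]
      by (auto intro!: derivative_eq_intros der[OF yU] simp: field_simps power2_eq_square)
    also have "(deriv F y * C y - F y * deriv C y) / (C y)\<^sup>2 =
        (\<nu> - 2 - m) / y * (F y / C y) - G y * A y / (C y)\<^sup>2"
      unfolding FC[OF yU] by (simp add: diff_divide_distrib power2_eq_square)
    also have "(deriv A y * B y - A y * deriv B y) / (A y)\<^sup>2 =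
        (\<nu> - 1 - m) / y * (B y / A y) - C y * E y / (A y)\<^sup>2"
      unfolding AB[OF yU] by (simp add: diff_divide_distrib power2_eq_square)
    also have "F y / C y * (B y / A y) +
        y * (((\<nu> - 2 - m) / y * (F y / C y) - G y * A y / (C y)\<^sup>2) * (B y / A y)
          - F y / C y * ((\<nu> - 1 - m) / y * (B y / A y) - C y * E y / (A y)\<^sup>2)) =
        y * (F y / C y) * (C y * E y / (A y)\<^sup>2) - y * (G y * A y / (C y)\<^sup>2) * (B y / A y)"
    proof -
      \<comment> \<open>The coefficients \<open>\<nu> - 2 - m\<close> and
        \<open>\<nu> - 1 - m\<close> differ by one, which cancels the term from differentiating the
        factor \<open>y\<close>.\<close>
      have "r * s + y * (((\<nu> - 2 - m) / y * r - X) * s - r * ((\<nu> - 1 - m) / y * s - Z)) =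
          y * r * Z - y * X * s" for r s X Z
        by (simp add: field_simps)
      then show ?thesis .
    qed
    also have "\<dots> = (P y - m - 1) * w y - (P y + m + 1) / w y"
    proof -
      \<comment> \<open>The second form of \<open>P\<close> absorbs \<open>G\<close>, and the first
        one, used next, absorbs \<open>F\<close>.\<close>
      have "(P y - m - 1) * w y = - (y * (G y * A y / (C y)\<^sup>2) * (B y / A y))"
        unfolding P'[OF yU] w by (simp add: field_simps power2_eq_square)
      moreover have "(P y + m + 1) / w y = - (y * (F y / C y) * (C y * E y / (A y)\<^sup>2))"
        unfolding P_def w by (simp add: field_simps power2_eq_square)
      ultimately show ?thesis by simp
    qed
    finally show ?thesis .
  qed
  moreover have "x \<in> U" "0 \<notin> U" using x nz zero_notin_S by (auto simp: U_def ABC)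
  moreover have "w y \<noteq> 0" if "y \<in> U" for y using y[OF that] by (simp add: w)
  ultimately show ?thesis
    using painleve_III_of_first_order_system[OF \<open>open U\<close>, of x w \<nu> P m] by (simp add: w_def m_def)
qed

text \<open>Each of the four determinants vanishes at most on a sparse set, and off the union of
  these sets the pointwise result applies. The nonvanishing clauses ensure that no quotient in the
  equation takes the default value of a division by zero.\<close>

theorem painleve_III:
  "u n \<nu> meromorphic_on S \<and>
    (\<forall>\<^sub>\<approx>x\<in>S. D (n + 1) \<nu> x * D n (\<nu> - 1) x \<noteq> 0 \<and> u n \<nu> x \<noteq> 0 \<and>
      deriv (deriv (u n \<nu>)) x = (deriv (u n \<nu>) x)\<^sup>2 / u n \<nu> x - deriv (u n \<nu>) x / x
      + ((2 * \<nu> + 2 * of_nat n) * (u n \<nu> x)\<^sup>2 + (- (2 * \<nu>) + 2 + 2 * of_nat n)) / x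
      + (u n \<nu> x) ^ 3 - 1 / u n \<nu> x)"
proof
  have mero: "D k \<mu> meromorphic_on S" for k \<mu>
    using D_holomorphic open_S by (simp add: analytic_on_imp_meromorphic_on analytic_on_open)
  show "u n \<nu> meromorphic_on S"
    unfolding u_def[abs_def] by (intro meromorphic_intros mero)
  have ev: "\<forall>\<^sub>\<approx>x\<in>S. D k \<mu> x \<noteq> 0" for k \<mu>
    by (intro eventually_nonzero D_holomorphic D_not_identically_zero)
  show "\<forall>\<^sub>\<approx>x\<in>S. D (n + 1) \<nu> x * D n (\<nu> - 1) x \<noteq> 0 \<and> u n \<nu> x \<noteq> 0 \<and>
      deriv (deriv (u n \<nu>)) x = (deriv (u n \<nu>) x)\<^sup>2 / u n \<nu> x - deriv (u n \<nu>) x / x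
      + ((2 * \<nu> + 2 * of_nat n) * (u n \<nu> x)\<^sup>2 + (- (2 * \<nu>) + 2 + 2 * of_nat n)) / x
      + (u n \<nu> x) ^ 3 - 1 / u n \<nu> x"
    using ev[of "n + 1" \<nu>] ev[of n "\<nu> - 1"] ev[of "n + 1" "\<nu> - 1"] ev[of n \<nu>]
      eventually_in_cosparse[OF subset_refl open_S]
  proof eventually_elim
    case (elim x)
    then show ?case using painleve_III_at[of x n \<nu>] by (simp add: u_def)
  qed
qed

end

section \<open>Bessel functions of complex order\<close>

definition bessel_coeff :: "complex \<Rightarrow> nat \<Rightarrow> complex" where
  "bessel_coeff \<nu> k = (-1) ^ k * rGamma (\<nu> + of_nat k + 1) / fact k"

text \<open>The Bessel-Clifford function at \<open>- z\<close>: the single-valued factor of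
  \<open>Bessel_J\<close>, entire in the order and in \<open>z = (x / 2)\<^sup>2\<close>.\<close>

definition bessel_entire :: "complex \<Rightarrow> complex \<Rightarrow> complex" where
  "bessel_entire \<nu> z = (\<Sum>k. bessel_coeff \<nu> k * z ^ k)"

lemma Bessel_J_eq: "Bessel_J \<nu> x = (x / 2) powr \<nu> * bessel_entire \<nu> ((x / 2)\<^sup>2)"
  unfolding Bessel_J_def bessel_entire_def bessel_coeff_def by (simp add: power_mult)

text \<open>By \<open>rGamma w = w * rGamma (w + 1)\<close> the norm cannot grow from
  \<open>w\<close> to \<open>w + 1\<close> once \<open>norm w \<ge> 1\<close>. This leaves finitely
  many shifts, which stay in a compact ball.\<close>

lemma rGamma_shift_bounded:
  obtains B where "\<And>\<nu> k. norm \<nu> \<le> R \<Longrightarrow> norm (rGamma (\<nu> + of_nat k + 1 :: complex)) \<le> B"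
proof -
  obtain K :: nat where K: "R \<le> K" using real_arch_simple by blast
  have "compact (rGamma ` cball (0 :: complex) (R + real K + 1))"
    by (intro compact_continuous_image holomorphic_on_imp_continuous_on holomorphic_rGamma) auto
  then obtain B where B: "\<And>z :: complex. norm z \<le> R + real K + 1 \<Longrightarrow> norm (rGamma z) \<le> B"
    by (fastforce dest!: compact_imp_bounded simp: bounded_iff)
  have "norm (rGamma (\<nu> + of_nat k + 1)) \<le> B" if \<nu>: "norm \<nu> \<le> R" for \<nu> :: complex and k
  proof (induction k)
    case 0
    have "norm (\<nu> + 1) \<le> R + 1" using \<nu> norm_triangle_ineq[of \<nu> 1] by simp
    then show ?case using B[of "\<nu> + 1"] by simp
  next
    case (Suc k)
    show ?case
    proof (cases "Suc k \<le> K")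
      case True
      have "norm (\<nu> + of_nat (Suc k) + 1) \<le> norm \<nu> + norm (of_nat (Suc k + 1) :: complex)"
        using norm_triangle_ineq[of \<nu> "of_nat (Suc k + 1)"] by (simp add: algebra_simps)
      also have "\<dots> \<le> R + real K + 1" using \<nu> True by (simp only: norm_of_nat)
      finally show ?thesis by (rule B)
    next
      case False
      define w where "w = \<nu> + of_nat k + 1"
      have "real (Suc k) - norm \<nu> \<le> norm w"
        using norm_diff_ineq[of "of_nat (Suc k)" \<nu>] norm_of_nat[of "Suc k", where 'a = complex]
        by (simp add: w_def algebra_simps)
      then have w: "1 \<le> norm w" using \<nu> K False by linarith
      have "norm (rGamma (w + 1)) * 1 \<le> norm (rGamma (w + 1)) * norm w"
        using w by (intro mult_left_mono) auto
      also have "\<dots> = norm (rGamma w)"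
        using rGamma_plus1[of w] by (metis norm_mult mult.commute)
      finally show ?thesis using Suc by (simp add: w_def algebra_simps)
    qed
  qed
  then show ?thesis using that by blast
qed

text \<open>The Weierstrass M-test against an exponential series, uniform in order and argument
  together, so that joint continuity and holomorphy in the order both follow from it.\<close>

lemma bessel_entire_uniform_limit:
  assumes "bounded A" "bounded C"
  shows "uniform_limit (A \<times> C) (\<lambda>n (\<nu>, z). \<Sum>k<n. bessel_coeff \<nu> k * z ^ k)
    (\<lambda>(\<nu>, z). bessel_entire \<nu> z) sequentially"
proof -
  obtain R where R: "\<And>\<nu>. \<nu> \<in> A \<Longrightarrow> norm \<nu> \<le> R"
    using assms(1) by (auto simp: bounded_iff)
  obtain r where r: "\<And>z. z \<in> C \<Longrightarrow> norm z \<le> r"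
    using assms(2) by (auto simp: bounded_iff)
  obtain B where B: "\<And>\<nu> k. norm \<nu> \<le> R \<Longrightarrow> norm (rGamma (\<nu> + of_nat k + 1 :: complex)) \<le> B"
    using rGamma_shift_bounded[of R] by blast
  define M where "M k = B * (inverse (fact k) * r ^ k)" for k
  have "norm (bessel_coeff \<nu> k * z ^ k) \<le> M k" if "\<nu> \<in> A" "z \<in> C" for \<nu> z k
  proof -
    have "norm (bessel_coeff \<nu> k * z ^ k) =
        norm (rGamma (\<nu> + of_nat k + 1)) * (inverse (fact k) * norm z ^ k)"
      by (simp add: bessel_coeff_def norm_mult norm_divide norm_power field_simps)
    also have "\<dots> \<le> M k"
      unfolding M_def using B[OF R[OF that(1)], of k] r[OF that(2)]
      by (intro mult_mono power_mono) (auto intro: order_trans[OF norm_ge_zero])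
    finally show ?thesis .
  qed
  moreover have "summable M"
    unfolding M_def by (intro summable_mult summable_exp)
  ultimately have "uniform_limit (A \<times> C) (\<lambda>n p. \<Sum>k<n. bessel_coeff (fst p) k * snd p ^ k)
      (\<lambda>p. \<Sum>k. bessel_coeff (fst p) k * snd p ^ k) sequentially"
    by (intro Weierstrass_m_test) auto
  then show ?thesis by (simp add: case_prod_unfold bessel_entire_def)
qed

lemma continuous_bessel_coeff [continuous_intros]:
  "continuous_on A g \<Longrightarrow> continuous_on A (\<lambda>p. bessel_coeff (g p) k)"
  unfolding bessel_coeff_def
  by (intro continuous_intros continuous_on_compose2[OF holomorphic_on_imp_continuous_on[OF holomorphic_rGamma[of UNIV]]])
    auto

lemma continuous_on_bessel_entire: "continuous_on UNIV (\<lambda>(\<nu>, z). bessel_entire \<nu> z)"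
proof -
  have "isCont (\<lambda>(\<nu>, z). bessel_entire \<nu> z) p" for p :: "complex \<times> complex"
  proof -
    define R where "R = norm p + 1"
    have "continuous_on (ball 0 R \<times> ball 0 R) (\<lambda>(\<nu>, z). bessel_entire \<nu> z)"
      by (rule uniform_limit_theorem[OF _ bessel_entire_uniform_limit])
        (auto simp: case_prod_unfold intro!: continuous_intros always_eventually)
    moreover have "open (ball (0 :: complex) R \<times> ball (0 :: complex) R)" by (intro open_Times) auto
    moreover have "p \<in> ball 0 R \<times> ball 0 R"
      using norm_fst_le[of "fst p" "snd p"] norm_snd_le[of "snd p" "fst p"] by (auto simp: mem_Times_iff R_def)
    ultimately show ?thesis using continuous_on_eq_continuous_at by blast
  qed
  then show ?thesis by (simp add: continuous_on_eq_continuous_at)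
qed

lemma bessel_entire_holomorphic_order: "(\<lambda>\<nu>. bessel_entire \<nu> z) holomorphic_on UNIV"
proof (rule holomorphic_uniform_sequence)
  show "(\<lambda>\<nu>. \<Sum>k<n. bessel_coeff \<nu> k * z ^ k) holomorphic_on UNIV" for n
    unfolding bessel_coeff_def by (intro holomorphic_intros) auto
  show "\<exists>d>0. cball \<nu> d \<subseteq> UNIV \<and>
      uniform_limit (cball \<nu> d) (\<lambda>n \<nu>. \<Sum>k<n. bessel_coeff \<nu> k * z ^ k) (\<lambda>\<nu>. bessel_entire \<nu> z) sequentially" for \<nu>
    using bessel_entire_uniform_limit[of "cball \<nu> 1" "{z}"]
    by (intro exI[of _ 1]) (auto simp: uniform_limit_iff elim!: eventually_mono)
qed simp

lemma summable_bessel: "summable (\<lambda>k. bessel_coeff \<nu> k * z ^ k)"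
proof -
  have "(\<lambda>n. \<Sum>k<n. bessel_coeff \<nu> k * z ^ k) \<longlonglongrightarrow> bessel_entire \<nu> z"
    using tendsto_uniform_limitI[OF bessel_entire_uniform_limit[of "{\<nu>}" "{z}"], of "(\<nu>, z)"] by simp
  then show ?thesis by (auto simp: summable_def sums_def)
qed

lemma diffs_bessel_coeff: "diffs (bessel_coeff \<nu>) = (\<lambda>k. - bessel_coeff (\<nu> + 1) k)"
proof
  fix k
  have "of_nat (Suc k) * (x / fact (Suc k)) = (x / fact k :: complex)" for x
    by (simp add: fact_Suc del: of_nat_Suc)
  moreover have "\<nu> + of_nat (Suc k) + 1 = \<nu> + 1 + of_nat k + 1" by simp
  ultimately show "diffs (bessel_coeff \<nu>) k = - bessel_coeff (\<nu> + 1) k"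
    unfolding diffs_def bessel_coeff_def by simp
qed

lemma has_field_derivative_bessel_entire:
  "(bessel_entire \<nu> has_field_derivative - bessel_entire (\<nu> + 1) z) (at z)"
proof -
  have "((\<lambda>z. \<Sum>k. bessel_coeff \<nu> k * z ^ k) has_field_derivative
      (\<Sum>k. diffs (bessel_coeff \<nu>) k * z ^ k)) (at z)"
    by (intro termdiffs_strong_converges_everywhere summable_bessel)
  also have "(\<Sum>k. diffs (bessel_coeff \<nu>) k * z ^ k) = - bessel_entire (\<nu> + 1) z"
    by (simp add: diffs_bessel_coeff bessel_entire_def suminf_minus summable_bessel)
  finally show ?thesis by (simp add: bessel_entire_def[abs_def])
qed

text \<open>Coefficientwise the functional equation of \<open>rGamma\<close> yields the factor
  \<open>\<nu> + k\<close>; the part weighted by \<open>k\<close> is \<open>z\<close> times the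
  derivative of the series.\<close>

lemma bessel_entire_recurrence:
  "bessel_entire (\<nu> - 1) z = \<nu> * bessel_entire \<nu> z - z * bessel_entire (\<nu> + 1) z"
proof -
  have coeff: "bessel_coeff (\<nu> - 1) k = \<nu> * bessel_coeff \<nu> k + of_nat k * bessel_coeff \<nu> k" for k
  proof -
    have "rGamma (\<nu> + of_nat k) = (\<nu> + of_nat k) * rGamma (\<nu> + of_nat k + 1)"
      by (rule rGamma_plus1[symmetric])
    then show ?thesis by (simp add: bessel_coeff_def distrib_right distrib_left add_divide_distrib mult_ac)
  qed
  have "(\<lambda>k. diffs (bessel_coeff \<nu>) k * z ^ k) sums - bessel_entire (\<nu> + 1) z"
    using sums_minus[OF summable_sums[OF summable_bessel]]
    by (simp add: diffs_bessel_coeff bessel_entire_def)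
  then have "(\<lambda>k. z * (diffs (bessel_coeff \<nu>) k * z ^ k)) sums (z * (- bessel_entire (\<nu> + 1) z))"
    by (rule sums_mult)
  then have "(\<lambda>k. of_nat (Suc k) * bessel_coeff \<nu> (Suc k) * z ^ Suc k) sums (z * (- bessel_entire (\<nu> + 1) z))"
    by (simp add: diffs_def mult_ac)
  then have "(\<lambda>k. of_nat k * bessel_coeff \<nu> k * z ^ k) sums (z * (- bessel_entire (\<nu> + 1) z))"
    by (subst (asm) sums_Suc_iff) simp
  from sums_add[OF this] have "(\<lambda>k. of_nat k * bessel_coeff \<nu> k * z ^ k + \<nu> * (bessel_coeff \<nu> k * z ^ k)) sums
      (z * (- bessel_entire (\<nu> + 1) z) + \<nu> * bessel_entire \<nu> z)"
    unfolding bessel_entire_def by (simp add: sums_mult summable_sums summable_bessel)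
  then have "(\<lambda>k. bessel_coeff (\<nu> - 1) k * z ^ k) sums
      (z * (- bessel_entire (\<nu> + 1) z) + \<nu> * bessel_entire \<nu> z)"
    by (simp add: coeff algebra_simps)
  then show ?thesis
    unfolding bessel_entire_def[of "\<nu> - 1"] by (simp add: sums_iff)
qed

text \<open>The left side has derivative zero by the recurrences, hence equals its value at 0, which
  the reflection formula evaluates. The entire factor is used because 0 is a branch point of
  \<open>Bessel_J\<close>.\<close>

lemma bessel_entire_casoratian:
  "z * bessel_entire (\<nu> + 1) z * bessel_entire (- \<nu>) z + bessel_entire \<nu> z * bessel_entire (- \<nu> - 1) z =
    - (sin (\<nu> * of_real pi) / of_real pi)"
proof -
  let ?G = bessel_entire
  define H where "H z = z * ?G (\<nu> + 1) z * ?G (- \<nu>) z + ?G \<nu> z * ?G (- \<nu> - 1) z" for z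
  have "(H has_field_derivative 0) (at z)" for z
  proof -
    have 1: "z * ?G (\<nu> + 2) z = (\<nu> + 1) * ?G (\<nu> + 1) z - ?G \<nu> z"
      using bessel_entire_recurrence[of "\<nu> + 1" z] by (simp add: algebra_simps)
    have 2: "z * ?G (1 - \<nu>) z = - \<nu> * ?G (- \<nu>) z - ?G (- \<nu> - 1) z"
      using bessel_entire_recurrence[of "- \<nu>" z] by (simp add: algebra_simps)
    have "(H has_field_derivative ?G (\<nu> + 1) z * ?G (- \<nu>) z - z * ?G (\<nu> + 2) z * ?G (- \<nu>) z -
        z * ?G (1 - \<nu>) z * ?G (\<nu> + 1) z - ?G (\<nu> + 1) z * ?G (- \<nu> - 1) z - ?G \<nu> z * ?G (- \<nu>) z) (at z)"
      unfolding H_def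
      by (auto intro!: derivative_eq_intros has_field_derivative_bessel_entire simp: algebra_simps)
    then show ?thesis unfolding 1 2 by (simp add: algebra_simps)
  qed
  then have "H z = H 0"
    using has_field_derivative_zero_constant[of UNIV H] by (metis UNIV_I convex_UNIV)
  also have "H 0 = rGamma (1 + \<nu>) * rGamma (- \<nu>)"
  proof -
    have "bessel_entire \<mu> 0 = rGamma (\<mu> + 1)" for \<mu>
      using powser_zero[of "bessel_coeff \<mu>"] by (simp add: bessel_entire_def bessel_coeff_def)
    then show ?thesis by (simp add: H_def add.commute)
  qed
  also have "\<dots> = - (sin (\<nu> * of_real pi) / of_real pi)"
    using rGamma_reflection_complex[of "- \<nu>"] by (simp add: mult.commute)
  finally show ?thesis by (simp add: H_def)
qed

text \<open>The zeros of \<open>rGamma\<close> at the nonpositive integers kill the first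
  \<open>n\<close> coefficients; the others are those of order \<open>n\<close> up to a shift and a
  sign.\<close>

lemma bessel_entire_minus_nat: "bessel_entire (- of_nat n) z = (- z) ^ n * bessel_entire (of_nat n) z"
proof -
  have coeff: "bessel_coeff (- of_nat n) (k + n) = (-1) ^ n * bessel_coeff (of_nat n) k" for k
  proof -
    have "rGamma (of_nat j + 1 :: complex) = 1 / fact j" for j
      using Gamma_fact[of j, where 'a = complex] by (simp add: rGamma_inverse_Gamma add.commute divide_inverse)
    from this[of k] this[of "n + k"] have "rGamma (of_nat k + 1 :: complex) = 1 / fact k"
      "rGamma (of_nat n + of_nat k + 1 :: complex) = 1 / fact (n + k)" by simp_all
    then show ?thesis
      by (simp add: bessel_coeff_def power_add add.commute[of k n] mult_ac)
  qed
  have "bessel_coeff (- of_nat n) k = 0" if "k < n" for k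
  proof -
    have "- of_nat n + of_nat k + 1 = (- of_nat (n - k - 1) :: complex)"
      using that by (simp add: of_nat_diff)
    then show ?thesis by (simp add: bessel_coeff_def rGamma_eq_zero_iff)
  qed
  then have "(\<Sum>k<n. bessel_coeff (- of_nat n) k * z ^ k) = 0" by simp
  then have "bessel_entire (- of_nat n) z = (\<Sum>k. bessel_coeff (- of_nat n) (k + n) * z ^ (k + n))"
    unfolding bessel_entire_def by (subst suminf_split_initial_segment[of _ n]) (auto intro: summable_bessel)
  also have "\<dots> = (\<Sum>k. (- z) ^ n * (bessel_coeff (of_nat n) k * z ^ k))"
    unfolding coeff by (simp add: power_add power_minus[of z] mult_ac)
  also have "\<dots> = (- z) ^ n * bessel_entire (of_nat n) z"
    unfolding bessel_entire_def by (intro suminf_mult summable_bessel)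
  finally show ?thesis .
qed

section \<open>Recurrences and Casoratian of the function of the first kind\<close>

lemma half_notin_nonpos_Reals: "x \<in> - \<real>\<^sub>\<le>\<^sub>0 \<Longrightarrow> x / 2 \<notin> \<real>\<^sub>\<le>\<^sub>0" for x :: complex
  by (auto simp: complex_nonpos_Reals_iff)

lemma notin_nonpos_Reals_nonzero: "x \<in> - \<real>\<^sub>\<le>\<^sub>0 \<Longrightarrow> x \<noteq> 0" for x :: complex
  by auto

lemma Bessel_J_raise:
  assumes x: "x \<in> - \<real>\<^sub>\<le>\<^sub>0"
  shows "(Bessel_J \<nu> has_field_derivative \<nu> / x * Bessel_J \<nu> x - Bessel_J (\<nu> + 1) x) (at x)"
proof -
  have [simp]: "x \<noteq> 0" using x by auto
  have p: "((\<lambda>x. (x / 2) powr \<nu>) has_field_derivative \<nu> / x * (x / 2) powr \<nu>) (at x)"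
    by (rule DERIV_cong[OF DERIV_chain2[where f = "\<lambda>z. z powr \<nu>" and g = "\<lambda>x. x / 2",
            OF has_field_derivative_powr[OF half_notin_nonpos_Reals[OF x]]]])
      (auto intro!: derivative_eq_intros simp: powr_diff)
  have g: "((\<lambda>x. bessel_entire \<nu> ((x / 2)\<^sup>2)) has_field_derivative
      - bessel_entire (\<nu> + 1) ((x / 2)\<^sup>2) * (x / 2)) (at x)"
    by (rule DERIV_cong[OF DERIV_chain2[where f = "bessel_entire \<nu>" and g = "\<lambda>x. (x / 2)\<^sup>2",
            OF has_field_derivative_bessel_entire]])
      (auto intro!: derivative_eq_intros)
  show ?thesis
    unfolding Bessel_J_eq[abs_def]
    by (rule DERIV_cong[OF DERIV_mult[OF p g]]) (simp add: powr_add mult_ac)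
qed

lemma Bessel_J_three_term:
  assumes "x \<noteq> 0"
  shows "Bessel_J (\<nu> - 1) x + Bessel_J (\<nu> + 1) x = 2 * \<nu> / x * Bessel_J \<nu> x"
proof -
  have "(x / 2) powr 1 = x / 2" using assms by simp
  then show ?thesis
    using assms unfolding Bessel_J_eq
    by (simp add: powr_add powr_diff bessel_entire_recurrence field_simps power2_eq_square)
qed

lemma Bessel_J_lower:
  assumes x: "x \<in> - \<real>\<^sub>\<le>\<^sub>0"
  shows "(Bessel_J \<nu> has_field_derivative Bessel_J (\<nu> - 1) x - \<nu> / x * Bessel_J \<nu> x) (at x)"
proof (rule DERIV_cong[OF Bessel_J_raise[OF x]])
  show "\<nu> / x * Bessel_J \<nu> x - Bessel_J (\<nu> + 1) x = Bessel_J (\<nu> - 1) x - \<nu> / x * Bessel_J \<nu> x"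
    using Bessel_J_three_term[OF notin_nonpos_Reals_nonzero[OF x], of \<nu>] by (simp add: algebra_simps)
qed

text \<open>The branch factors of the two products multiply to \<open>x / 2\<close> and to its
  inverse; taking out that inverse leaves the Casoratian of the entire factors.\<close>

lemma Bessel_J_casoratian:
  assumes "x \<noteq> 0"
  shows "Bessel_J (\<nu> + 1) x * Bessel_J (- \<nu>) x + Bessel_J \<nu> x * Bessel_J (- \<nu> - 1) x =
    - (2 * sin (\<nu> * of_real pi) / (of_real pi * x))"
proof -
  let ?w = "x / 2"
  define p where "p = ?w powr \<nu>"
  have "p \<noteq> 0" using assms by (simp add: p_def)
  then have "Bessel_J (\<nu> + 1) x * Bessel_J (- \<nu>) x + Bessel_J \<nu> x * Bessel_J (- \<nu> - 1) x =
    (?w\<^sup>2 * bessel_entire (\<nu> + 1) (?w\<^sup>2) * bessel_entire (- \<nu>) (?w\<^sup>2) +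
      bessel_entire \<nu> (?w\<^sup>2) * bessel_entire (- \<nu> - 1) (?w\<^sup>2)) / ?w"
    unfolding Bessel_J_eq powr_add powr_diff powr_minus p_def[symmetric] using assms
    by (simp add: field_simps power2_eq_square)
  then show ?thesis
    unfolding bessel_entire_casoratian using assms by (simp add: mult_ac)
qed

lemma Bessel_J_holomorphic_order [holomorphic_intros]:
  assumes "g holomorphic_on A" "x \<noteq> 0"
  shows "(\<lambda>w. Bessel_J (g w) x) holomorphic_on A"
proof -
  have "(\<lambda>\<nu>. Bessel_J \<nu> x) holomorphic_on UNIV"
    unfolding Bessel_J_eq powr_def using assms
    by (auto intro!: holomorphic_intros bessel_entire_holomorphic_order)
  then show ?thesis
    using holomorphic_on_compose_gen[OF assms(1), of _ UNIV] by (auto simp: o_def)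
qed

lemma continuous_on_Bessel_J [continuous_intros]:
  assumes "continuous_on A g" "continuous_on A h" "\<And>p. p \<in> A \<Longrightarrow> h p \<in> - \<real>\<^sub>\<le>\<^sub>0"
  shows "continuous_on A (\<lambda>p. Bessel_J (g p) (h p))"
proof -
  have "continuous_on A (\<lambda>p. bessel_entire (g p) ((h p / 2)\<^sup>2))"
    using continuous_on_compose2[OF continuous_on_bessel_entire, of A "\<lambda>p. (g p, (h p / 2)\<^sup>2)"] assms(1,2)
    by (simp add: continuous_intros)
  moreover have "continuous_on A (\<lambda>p. exp (g p * Ln (h p / 2)))"
    using assms half_notin_nonpos_Reals by (intro continuous_intros) auto
  moreover have "(h p / 2) powr g p = exp (g p * Ln (h p / 2))" if "p \<in> A" for p
    using assms(3)[OF that] by (auto simp: powr_def)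
  ultimately show ?thesis
    unfolding Bessel_J_eq by (auto intro!: continuous_intros cong: continuous_on_cong)
qed

lemma Bessel_J_minus_nat:
  assumes "x \<noteq> 0"
  shows "Bessel_J (- of_nat n) x = (-1) ^ n * Bessel_J (of_nat n) x"
proof -
  define w where "w = x / 2"
  have "w \<noteq> 0" using assms by (simp add: w_def)
  moreover from this have "w powr of_nat n = w ^ n" by (intro powr_nat') auto
  moreover have "(- w\<^sup>2) ^ n = (-1) ^ n * (w ^ n * w ^ n)"
    by (subst power_minus) (simp add: power2_eq_square power_mult_distrib)
  ultimately show ?thesis
    by (simp add: Bessel_J_eq bessel_entire_minus_nat powr_minus flip: w_def)
qed

lemma sin_cos_pi_of_int:
  shows "sin (of_int m * of_real pi :: complex) = 0"
    and "cos (of_int m * of_real pi :: complex) = (-1) powi m"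
proof -
  have "sin (of_int m * of_real pi :: complex) = of_real (sin (of_int m * pi))"
    by (metis of_real_mult of_real_of_int_eq sin_of_real)
  then show "sin (of_int m * of_real pi :: complex) = 0"
    by (simp add: sin_integer_2pi mult.commute[of _ pi] sin_npi_int)
  have "cos (of_int m * of_real pi :: complex) = of_real (cos (of_int m * pi))"
    by (metis of_real_mult of_real_of_int_eq cos_of_real)
  then show "cos (of_int m * of_real pi :: complex) = (-1) powi m"
    by (simp add: mult.commute[of _ pi] cos_npi_int power_int_minus_left)
qed

text \<open>The sign is written as a cosine because this is then exactly the vanishing of the
  numerator in the quotient that defines \<open>Bessel_Y\<close>.\<close>

lemma Bessel_J_minus_Ints:
  assumes "x \<noteq> 0" "\<nu> \<in> \<int>"
  shows "Bessel_J (- \<nu>) x = cos (\<nu> * of_real pi) * Bessel_J \<nu> x"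
proof -
  obtain m where m: "\<nu> = of_int m" using assms(2) by (auto elim: Ints_cases)
  show ?thesis
  proof (cases "m \<ge> 0")
    case True
    then obtain n where "m = int n" by (metis nonneg_int_cases)
    then show ?thesis using Bessel_J_minus_nat[OF assms(1), of n] sin_cos_pi_of_int(2)[of m] by (simp add: m)
  next
    case False
    then obtain n where "m = - int n" by (metis int_cases2 of_nat_0_le_iff)
    then show ?thesis using Bessel_J_minus_nat[OF assms(1), of n] sin_cos_pi_of_int(2)[of m]
      by (simp add: m power_int_minus flip: power_mult_distrib)
  qed
qed

section \<open>The function of the second kind and its dependence on the order\<close>

definition Bessel_Y_quotient :: "complex \<Rightarrow> complex \<Rightarrow> complex" where
  "Bessel_Y_quotient \<nu> x =
    (Bessel_J \<nu> x * cos (\<nu> * of_real pi) - Bessel_J (- \<nu>) x) / sin (\<nu> * of_real pi)"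

lemma Bessel_Y_notin_Ints: "\<nu> \<notin> \<int> \<Longrightarrow> Bessel_Y \<nu> x = Bessel_Y_quotient \<nu> x"
  by (simp add: Bessel_Y_def Bessel_Y_quotient_def Let_def)

lemma Bessel_Y_Ints: "\<nu> \<in> \<int> \<Longrightarrow> Bessel_Y \<nu> x = Lim (at \<nu>) (\<lambda>\<mu>. Bessel_Y_quotient \<mu> x)"
  by (simp add: Bessel_Y_def Bessel_Y_quotient_def Let_def)

lemma sin_pi_eq_0_iff: "sin (\<nu> * of_real pi) = 0 \<longleftrightarrow> \<nu> \<in> \<int>" for \<nu> :: complex
proof
  assume "sin (\<nu> * of_real pi) = 0"
  then obtain n :: int where "\<nu> * of_real pi = of_real (real_of_int n * pi)"
    by (auto simp: sin_eq_0)
  then have "\<nu> = of_int n" by simp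
  then show "\<nu> \<in> \<int>" by simp
next
  assume "\<nu> \<in> \<int>"
  then show "sin (\<nu> * of_real pi) = 0" by (auto elim!: Ints_cases simp: sin_cos_pi_of_int)
qed

lemma Bessel_Y_quotient_holomorphic_order:
  "x \<noteq> 0 \<Longrightarrow> (\<lambda>\<nu>. Bessel_Y_quotient \<nu> x) holomorphic_on (- \<int>)"
  unfolding Bessel_Y_quotient_def
  by (intro holomorphic_intros) (auto simp: sin_pi_eq_0_iff)

text \<open>At an integer order numerator and denominator vanish, and the zero of the denominator is simple.\<close>

lemma Bessel_Y_quotient_tendsto:
  assumes x: "x \<noteq> 0" and \<nu>: "\<nu> \<in> \<int>"
  shows "((\<lambda>\<mu>. Bessel_Y_quotient \<mu> x) \<longlongrightarrow> Bessel_Y \<nu> x) (at \<nu>)"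
proof -
  define N where "N \<mu> = Bessel_J \<mu> x * cos (\<mu> * of_real pi) - Bessel_J (- \<mu>) x" for \<mu>
  define s where "s \<mu> = sin (\<mu> * of_real pi)" for \<mu> :: complex
  have "N holomorphic_on UNIV"
    unfolding N_def using x
    by (intro holomorphic_intros) auto
  then have "(N has_field_derivative deriv N \<nu>) (at \<nu>)"
    by (rule holomorphic_derivI) auto
  moreover have s0: "s \<nu> = 0" using \<nu> by (simp add: s_def sin_pi_eq_0_iff)
  have "(cos (\<nu> * of_real pi))\<^sup>2 = 1"
    using s0 sin_cos_squared_add[of "\<nu> * of_real pi"] by (simp add: s_def)
  then have "N \<nu> = 0"
    by (simp add: N_def Bessel_J_minus_Ints[OF x \<nu>])
  ultimately have lim_N: "((\<lambda>\<mu>. N \<mu> / (\<mu> - \<nu>)) \<longlongrightarrow> deriv N \<nu>) (at \<nu>)"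
    by (simp add: has_field_derivative_iff)
  have "(s has_field_derivative cos (\<nu> * of_real pi) * of_real pi) (at \<nu>)"
    unfolding s_def by (auto intro!: derivative_eq_intros)
  then have lim_s: "((\<lambda>\<mu>. s \<mu> / (\<mu> - \<nu>)) \<longlongrightarrow> cos (\<nu> * of_real pi) * of_real pi) (at \<nu>)"
    using s0 by (simp add: has_field_derivative_iff)
  \<comment> \<open>Both difference quotients converge, and the lower limit is nonzero because the
    cosine squares to 1.\<close>
  have "((\<lambda>\<mu>. (N \<mu> / (\<mu> - \<nu>)) / (s \<mu> / (\<mu> - \<nu>))) \<longlongrightarrow>
      deriv N \<nu> / (cos (\<nu> * of_real pi) * of_real pi)) (at \<nu>)"
    using \<open>(cos (\<nu> * of_real pi))\<^sup>2 = 1\<close> by (intro tendsto_divide lim_N lim_s) auto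
  moreover have "\<forall>\<^sub>F \<mu> in at \<nu>. (N \<mu> / (\<mu> - \<nu>)) / (s \<mu> / (\<mu> - \<nu>)) = Bessel_Y_quotient \<mu> x"
    by (auto simp: eventually_at_filter N_def s_def Bessel_Y_quotient_def)
  ultimately have lim: "((\<lambda>\<mu>. Bessel_Y_quotient \<mu> x) \<longlongrightarrow>
      deriv N \<nu> / (cos (\<nu> * of_real pi) * of_real pi)) (at \<nu>)"
    by (rule Lim_transform_eventually)
  then have "Bessel_Y \<nu> x = deriv N \<nu> / (cos (\<nu> * of_real pi) * of_real pi)"
    unfolding Bessel_Y_Ints[OF \<nu>] by (intro tendsto_Lim) auto
  with lim show ?thesis by simp
qed

lemma open_minus_Ints: "open (- \<int> :: complex set)"
  by (simp add: closed_Ints open_Compl)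

lemma notin_Ints_of_dist_less_1:
  fixes \<mu> \<nu> :: complex
  assumes "\<nu> \<in> \<int>" "dist \<nu> \<mu> < 1" "\<mu> \<noteq> \<nu>"
  shows "\<mu> \<notin> \<int>"
proof
  assume "\<mu> \<in> \<int>"
  then obtain m n where mn: "\<mu> = of_int m" "\<nu> = of_int n" using assms(1) by (auto elim!: Ints_cases)
  then have "norm (of_int (n - m) :: complex) < 1" using assms(2) by (simp add: dist_norm)
  then have "\<bar>n - m\<bar> < 1" unfolding norm_of_int by linarith
  then show False using mn assms(3) by simp
qed

text \<open>Off the integers this is a quotient of holomorphic functions; the limit just established
  makes each integer a removable singularity.\<close>

lemma Bessel_Y_holomorphic_order [holomorphic_intros]:
  assumes g: "g holomorphic_on A" and x: "x \<noteq> 0"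
  shows "(\<lambda>w. Bessel_Y (g w) x) holomorphic_on A"
proof -
  have hol: "(\<lambda>\<nu>. Bessel_Y \<nu> x) holomorphic_on (- \<int>)"
    using Bessel_Y_quotient_holomorphic_order[OF x] by (rule holomorphic_transform) (simp add: Bessel_Y_notin_Ints)
  have "(\<lambda>\<nu>. Bessel_Y \<nu> x) field_differentiable at \<nu>" for \<nu>
  proof (cases "\<nu> \<in> \<int>")
    case False
    then show ?thesis using hol open_minus_Ints
      by (auto simp: holomorphic_on_open field_differentiable_def)
  next
    case True
    have lim: "((\<lambda>\<mu>. Bessel_Y \<mu> x) \<longlongrightarrow> Bessel_Y \<nu> x) (at \<nu>)"
    proof (rule Lim_transform_eventually[OF Bessel_Y_quotient_tendsto[OF x True]])
      show "\<forall>\<^sub>F \<mu> in at \<nu>. Bessel_Y_quotient \<mu> x = Bessel_Y \<mu> x"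
        unfolding eventually_at using True
        by (intro exI[of _ 1]) (auto simp: dist_commute Bessel_Y_notin_Ints notin_Ints_of_dist_less_1)
    qed
    have hol': "(\<lambda>\<mu>. Bessel_Y \<mu> x) holomorphic_on (ball \<nu> 1 - {\<nu>})"
      by (rule holomorphic_on_subset[OF hol]) (use True notin_Ints_of_dist_less_1 in auto)
    have "(\<lambda>\<mu>. Bessel_Y \<mu> x) holomorphic_on ball \<nu> 1"
      by (rule no_isolated_singularity'[OF _ hol' open_ball]) (use lim in \<open>auto intro: tendsto_within_subset\<close>)
    then show ?thesis by (rule holomorphic_on_imp_differentiable_at) auto
  qed
  then have "(\<lambda>\<nu>. Bessel_Y \<nu> x) holomorphic_on UNIV"
    by (simp add: holomorphic_on_def)
  then show ?thesis
    using holomorphic_on_compose_gen[OF g, of _ UNIV] by (auto simp: o_def)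
qed

section \<open>Recurrences of the second kind, carried to integer orders\<close>

lemma circle_mean_value:
  assumes hol: "g holomorphic_on cball c r" and r: "0 < r"
  shows "((\<lambda>t. g (circlepath c r t)) has_integral g c) {0..1}"
proof -
  have "((\<lambda>u. g u / (u - c)) has_contour_integral (2 * of_real pi * \<i> * g c)) (circlepath c r)"
    using Cauchy_integral_circlepath_simple[OF hol, of c] r by simp
  then have "((\<lambda>t. g (circlepath c r t) / (circlepath c r t - c) *
      vector_derivative (circlepath c r) (at t within {0..1})) has_integral (2 * of_real pi * \<i> * g c)) {0..1}"
    by (simp add: has_contour_integral_def)
  \<comment> \<open>The velocity of the circle is \<open>2 * of_real pi * \<i>\<close> times the
    displacement from \<open>c\<close>, which cancels the Cauchy kernel.\<close>
  then have "((\<lambda>t. 2 * of_real pi * \<i> * g (circlepath c r t)) has_integral (2 * of_real pi * \<i> * g c)) {0..1}"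
  proof (rule has_integral_eq[rotated])
    fix t :: real assume "t \<in> {0..1}"
    then show "g (circlepath c r t) / (circlepath c r t - c) *
      vector_derivative (circlepath c r) (at t within {0..1}) = 2 * of_real pi * \<i> * g (circlepath c r t)"
      using r by (simp add: vector_derivative_circlepath01) (simp add: circlepath)
  qed
  from has_integral_mult_right[OF this, of "inverse (2 * of_real pi * \<i>)"]
  show ?thesis by (simp add: field_simps)
qed

text \<open>A derivative formula on a circle of orders extends to its centre, because both sides are
  the means of their values on the circle.\<close>

lemma has_field_derivative_at_centre:
  assumes S: "open S" "x \<in> S" and r: "0 < r"
    and h: "\<And>y. y \<in> S \<Longrightarrow> (\<lambda>\<mu>. h \<mu> y) holomorphic_on cball \<nu> r"
    and k: "\<And>y. y \<in> S \<Longrightarrow> (\<lambda>\<mu>. k \<mu> y) holomorphic_on cball \<nu> r"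
    and der: "\<And>\<mu> y. \<mu> \<in> sphere \<nu> r \<Longrightarrow> y \<in> S \<Longrightarrow> (h \<mu> has_field_derivative k \<mu> y) (at y)"
    and cont: "continuous_on (sphere \<nu> r \<times> S) (\<lambda>(\<mu>, y). k \<mu> y)"
  shows "(h \<nu> has_field_derivative k \<nu> x) (at x)"
proof -
  obtain e where e: "e > 0" "ball x e \<subseteq> S" using S open_contains_ball by blast
  let ?\<gamma> = "circlepath \<nu> r"
  have \<gamma>: "?\<gamma> t \<in> sphere \<nu> r" if "t \<in> cbox 0 1" for t
    using that r path_image_circlepath_nonneg[of r \<nu>] by (auto simp: path_image_def)
  have "((\<lambda>y. integral (cbox 0 1) (\<lambda>t. h (?\<gamma> t) y)) has_field_derivative
      integral (cbox 0 1) (\<lambda>t. k (?\<gamma> t) x)) (at x within ball x e)"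
  proof (rule leibniz_rule_field_derivative)
    show "((\<lambda>y. h (?\<gamma> t) y) has_field_derivative k (?\<gamma> t) y) (at y within ball x e)"
      if "y \<in> ball x e" "t \<in> cbox 0 1" for y t
      using that e by (intro has_field_derivative_at_within[OF der[OF \<gamma>]]) auto
    show "(\<lambda>t. h (?\<gamma> t) y) integrable_on cbox 0 1" if "y \<in> ball x e" for y
      unfolding cbox_interval
      by (rule has_integral_integrable[OF circle_mean_value[OF h r]]) (use that e in auto)
    have "continuous_on (cbox 0 1) ?\<gamma>"
      using path_circlepath[of \<nu> r] by (simp add: path_def)
    then have "continuous_on (ball x e \<times> cbox 0 1) (\<lambda>p. ?\<gamma> (snd p))"
      by (rule continuous_on_compose2) (auto intro: continuous_on_snd continuous_on_id)
    then have "continuous_on (ball x e \<times> cbox 0 1) (\<lambda>p. (?\<gamma> (snd p), fst p))"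
      by (intro continuous_on_Pair continuous_on_fst continuous_on_id)
    then have "continuous_on (ball x e \<times> cbox 0 1) (\<lambda>p. (\<lambda>(\<mu>, y). k \<mu> y) (?\<gamma> (snd p), fst p))"
      by (rule continuous_on_compose2[OF cont]) (use e \<gamma> in auto)
    then show "continuous_on (ball x e \<times> cbox 0 1) (\<lambda>(y, t). k (?\<gamma> t) y)"
      by (simp add: case_prod_unfold)
  qed (use e in auto)
  then have "((\<lambda>y. integral (cbox 0 1) (\<lambda>t. h (?\<gamma> t) y)) has_field_derivative
      integral (cbox 0 1) (\<lambda>t. k (?\<gamma> t) x)) (at x)"
    by (subst (asm) at_within_open) (use e in auto)
  \<comment> \<open>For every \<open>y\<close> in the ball the mean of \<open>h\<close> over the
    circle of orders is \<open>h \<nu> y\<close>, so the derivative of the mean is that of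
    \<open>h \<nu>\<close>.\<close>
  then have "(h \<nu> has_field_derivative integral (cbox 0 1) (\<lambda>t. k (?\<gamma> t) x)) (at x)"
    by (rule has_field_derivative_transform_within_open[OF _ open_ball[of x e]])
      (use e in \<open>auto intro!: integral_unique circle_mean_value[OF h r]\<close>)
  then show ?thesis
    using circle_mean_value[OF k[OF S(2)] r] by (simp add: integral_unique)
qed

lemma continuous_on_Bessel_Y_quotient:
  fixes A :: "'a::t2_space set"
  assumes "continuous_on A g" "continuous_on A h" "\<And>p. p \<in> A \<Longrightarrow> g p \<notin> \<int>" "\<And>p. p \<in> A \<Longrightarrow> h p \<in> - \<real>\<^sub>\<le>\<^sub>0"
  shows "continuous_on A (\<lambda>p. Bessel_Y_quotient (g p) (h p))"
  unfolding Bessel_Y_quotient_def using assms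
  by (intro continuous_intros) (auto simp: sin_pi_eq_0_iff)

text \<open>A unit shift changes the sign of both sine and cosine, so the neighbours can be written
  over the denominator of order \<open>\<nu>\<close>.\<close>

lemma Bessel_Y_quotient_shift:
  "Bessel_Y_quotient (\<nu> + 1) x =
    (Bessel_J (\<nu> + 1) x * cos (\<nu> * of_real pi) + Bessel_J (- \<nu> - 1) x) / sin (\<nu> * of_real pi)"
  "Bessel_Y_quotient (\<nu> - 1) x =
    (Bessel_J (\<nu> - 1) x * cos (\<nu> * of_real pi) + Bessel_J (- \<nu> + 1) x) / sin (\<nu> * of_real pi)"
proof -
  have frac: "(a * - c - b) / - s = (a * c + b) / s" for a b c s :: complex
    by (cases "s = 0") (auto simp: field_simps)
  have "sin ((\<nu> + 1) * of_real pi) = - sin (\<nu> * of_real pi)"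
    "cos ((\<nu> + 1) * of_real pi) = - cos (\<nu> * of_real pi)"
    "sin ((\<nu> - 1) * of_real pi) = - sin (\<nu> * of_real pi)"
    "cos ((\<nu> - 1) * of_real pi) = - cos (\<nu> * of_real pi)"
    by (simp_all add: distrib_right left_diff_distrib sin_add cos_add sin_diff cos_diff)
  moreover have "- (\<nu> + 1) = - \<nu> - 1" "- (\<nu> - 1) = - \<nu> + 1" by simp_all
  ultimately show
    "Bessel_Y_quotient (\<nu> + 1) x =
      (Bessel_J (\<nu> + 1) x * cos (\<nu> * of_real pi) + Bessel_J (- \<nu> - 1) x) / sin (\<nu> * of_real pi)"
    "Bessel_Y_quotient (\<nu> - 1) x =
      (Bessel_J (\<nu> - 1) x * cos (\<nu> * of_real pi) + Bessel_J (- \<nu> + 1) x) / sin (\<nu> * of_real pi)"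
    unfolding Bessel_Y_quotient_def by (simp_all only: frac)
qed

text \<open>The term of order \<open>- \<nu>\<close> is differentiated by lowering, since negation
  exchanges the two recurrences. At integer orders the quotient is 0 by totalised division, and the
  formula reads as the derivative of the zero function.\<close>

lemma Bessel_Y_quotient_raise:
  assumes x: "x \<in> - \<real>\<^sub>\<le>\<^sub>0"
  shows "(Bessel_Y_quotient \<nu> has_field_derivative
    \<nu> / x * Bessel_Y_quotient \<nu> x - Bessel_Y_quotient (\<nu> + 1) x) (at x)"
proof -
  have "(Bessel_Y_quotient \<nu> has_field_derivative
    ((\<nu> / x * Bessel_J \<nu> x - Bessel_J (\<nu> + 1) x) * cos (\<nu> * of_real pi) -
      (Bessel_J (- \<nu> - 1) x - - \<nu> / x * Bessel_J (- \<nu>) x)) / sin (\<nu> * of_real pi)) (at x)"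
    unfolding Bessel_Y_quotient_def[abs_def]
    by (intro DERIV_cdivide DERIV_diff DERIV_cmult_right Bessel_J_raise Bessel_J_lower x)
  then show ?thesis
    by (rule DERIV_cong) (simp add: Bessel_Y_quotient_shift,
      simp add: Bessel_Y_quotient_def add_divide_distrib diff_divide_distrib algebra_simps)
qed

lemma Bessel_Y_quotient_lower:
  assumes x: "x \<in> - \<real>\<^sub>\<le>\<^sub>0"
  shows "(Bessel_Y_quotient \<nu> has_field_derivative
    Bessel_Y_quotient (\<nu> - 1) x - \<nu> / x * Bessel_Y_quotient \<nu> x) (at x)"
proof -
  have "(Bessel_Y_quotient \<nu> has_field_derivative
    ((Bessel_J (\<nu> - 1) x - \<nu> / x * Bessel_J \<nu> x) * cos (\<nu> * of_real pi) -
      (- \<nu> / x * Bessel_J (- \<nu>) x - Bessel_J (- \<nu> + 1) x)) / sin (\<nu> * of_real pi)) (at x)"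
    unfolding Bessel_Y_quotient_def[abs_def]
    by (intro DERIV_cdivide DERIV_diff DERIV_cmult_right Bessel_J_raise Bessel_J_lower x)
  then show ?thesis
    by (rule DERIV_cong) (simp add: Bessel_Y_quotient_shift,
      simp add: Bessel_Y_quotient_def add_divide_distrib diff_divide_distrib algebra_simps)
qed

text \<open>Treats both recurrences at once: \<open>s = \<delta> = 1\<close> is raising,
  \<open>s = \<delta> = -1\<close> is lowering.\<close>

lemma has_field_derivative_Bessel_Y:
  fixes a b :: "complex \<Rightarrow> complex \<Rightarrow> complex" and \<delta> :: complex
  assumes x: "x \<in> - \<real>\<^sub>\<le>\<^sub>0" and \<delta>: "\<delta> \<in> \<int>"
    and q: "\<And>\<mu> y. \<mu> \<notin> \<int> \<Longrightarrow> y \<in> - \<real>\<^sub>\<le>\<^sub>0 \<Longrightarrow> (Bessel_Y_quotient \<mu> has_field_derivative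
      s * (\<mu> / y * Bessel_Y_quotient \<mu> y - Bessel_Y_quotient (\<mu> + \<delta>) y)) (at y)"
  shows "(Bessel_Y \<nu> has_field_derivative s * (\<nu> / x * Bessel_Y \<nu> x - Bessel_Y (\<nu> + \<delta>) x)) (at x)"
proof -
  have shift: "\<mu> + \<delta> \<notin> \<int>" if "\<mu> \<notin> \<int>" for \<mu>
    using that \<delta> Ints_diff[of "\<mu> + \<delta>" \<delta>] by auto
  have Y: "Bessel_Y \<mu> = Bessel_Y_quotient \<mu>" if "\<mu> \<notin> \<int>" for \<mu>
    using that by (auto simp: Bessel_Y_notin_Ints)
  have nonint: "(Bessel_Y \<mu> has_field_derivative s * (\<mu> / y * Bessel_Y \<mu> y - Bessel_Y (\<mu> + \<delta>) y)) (at y)"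
    if "\<mu> \<notin> \<int>" "y \<in> - \<real>\<^sub>\<le>\<^sub>0" for \<mu> y
    using q[OF that] that shift[OF that(1)] by (simp add: Y)
  show ?thesis
  proof (cases "\<nu> \<in> \<int>")
    case True
    \<comment> \<open>Radius 1/2 keeps the circle about an integer clear of all integers, and
      shifting by the integer \<open>\<delta>\<close> preserves this.\<close>
    have sph: "\<mu> \<notin> \<int>" if "\<mu> \<in> sphere \<nu> (1 / 2)" for \<mu>
    proof (rule notin_Ints_of_dist_less_1[OF True])
      have "dist \<nu> \<mu> = 1 / 2" using that by simp
      then show "dist \<nu> \<mu> < 1" "\<mu> \<noteq> \<nu>" by auto
    qed
    show ?thesis
    proof (rule has_field_derivative_at_centre[where S = "- \<real>\<^sub>\<le>\<^sub>0" and r = "1 / 2"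
          and k = "\<lambda>\<mu> y. s * (\<mu> / y * Bessel_Y \<mu> y - Bessel_Y (\<mu> + \<delta>) y)"])
      show "open (- \<real>\<^sub>\<le>\<^sub>0 :: complex set)" by (simp add: open_Compl)
      fix y :: complex assume y: "y \<in> - \<real>\<^sub>\<le>\<^sub>0"
      then have "y \<noteq> 0" by auto
      show "(\<lambda>\<mu>. Bessel_Y \<mu> y) holomorphic_on cball \<nu> (1 / 2)"
        using \<open>y \<noteq> 0\<close> by (intro holomorphic_intros)
      show "(\<lambda>\<mu>. s * (\<mu> / y * Bessel_Y \<mu> y - Bessel_Y (\<mu> + \<delta>) y)) holomorphic_on cball \<nu> (1 / 2)"
        using \<open>y \<noteq> 0\<close>
        by (intro holomorphic_intros)
    next
      show "continuous_on (sphere \<nu> (1 / 2) \<times> - \<real>\<^sub>\<le>\<^sub>0)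
        (\<lambda>(\<mu>, y). s * (\<mu> / y * Bessel_Y \<mu> y - Bessel_Y (\<mu> + \<delta>) y))"
      \<comment> \<open>On the circle \<open>Bessel_Y\<close> agrees with the quotient, for which
        continuity in order and argument jointly is known.\<close>
      proof (rule continuous_on_eq)
        show "continuous_on (sphere \<nu> (1 / 2) \<times> - \<real>\<^sub>\<le>\<^sub>0) (\<lambda>p. s * (fst p / snd p *
          Bessel_Y_quotient (fst p) (snd p) - Bessel_Y_quotient (fst p + \<delta>) (snd p)))"
          using sph shift[OF sph]
          by (intro continuous_intros continuous_on_Bessel_Y_quotient) auto
      qed (use sph shift[OF sph] in \<open>auto simp: Y\<close>)
    qed (use x sph nonint in auto)
  qed (use nonint x in simp)
qed

lemma Bessel_Y_raise:
  assumes "x \<in> - \<real>\<^sub>\<le>\<^sub>0"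
  shows "(Bessel_Y \<nu> has_field_derivative \<nu> / x * Bessel_Y \<nu> x - Bessel_Y (\<nu> + 1) x) (at x)"
  using has_field_derivative_Bessel_Y[OF assms, of 1 1] Bessel_Y_quotient_raise by simp

lemma Bessel_Y_lower:
  assumes "x \<in> - \<real>\<^sub>\<le>\<^sub>0"
  shows "(Bessel_Y \<nu> has_field_derivative Bessel_Y (\<nu> - 1) x - \<nu> / x * Bessel_Y \<nu> x) (at x)"
  using has_field_derivative_Bessel_Y[OF assms, of "-1" "-1"] Bessel_Y_quotient_lower by simp

text \<open>Off the integers the cosine terms cancel, and the Casoratian of \<open>Bessel_J\<close>
  remains, divided by the sine it contains. The value is independent of the order, so continuity
  extends it to the integers.\<close>

lemma Bessel_J_Bessel_Y_casoratian:
  assumes x: "x \<noteq> 0"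
  shows "Bessel_J (\<nu> + 1) x * Bessel_Y \<nu> x - Bessel_J \<nu> x * Bessel_Y (\<nu> + 1) x = 2 / (of_real pi * x)"
proof -
  define W where "W \<mu> = Bessel_J (\<mu> + 1) x * Bessel_Y \<mu> x - Bessel_J \<mu> x * Bessel_Y (\<mu> + 1) x" for \<mu>
  have W: "W \<mu> = 2 / (of_real pi * x)" if \<mu>: "\<mu> \<notin> \<int>" for \<mu>
  proof -
    have "\<mu> + 1 \<notin> \<int>" using \<mu> Ints_diff[of "\<mu> + 1" 1] by auto
    moreover have "sin (\<mu> * of_real pi) \<noteq> 0" using \<mu> by (simp add: sin_pi_eq_0_iff)
    ultimately have "W \<mu> = - (Bessel_J (\<mu> + 1) x * Bessel_J (- \<mu>) x + Bessel_J \<mu> x * Bessel_J (- \<mu> - 1) x) /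
        sin (\<mu> * of_real pi)"
      using \<mu> unfolding W_def
      by (simp add: Bessel_Y_notin_Ints Bessel_Y_quotient_shift) (simp add: Bessel_Y_quotient_def field_simps)
    then show ?thesis
      unfolding Bessel_J_casoratian[OF x] using \<open>sin (\<mu> * of_real pi) \<noteq> 0\<close> by simp
  qed
  have "W \<nu> = 2 / (of_real pi * x)"
  proof (cases "\<nu> \<in> \<int>")
    case True
    have "W holomorphic_on UNIV"
      unfolding W_def using x
      by (intro holomorphic_intros)
    then have "(W \<longlongrightarrow> W \<nu>) (at \<nu>)"
      using holomorphic_on_imp_continuous_on[of W UNIV] by (simp add: continuous_on_eq_continuous_at isCont_def)
    moreover have "\<forall>\<^sub>F \<mu> in at \<nu>. W \<mu> = 2 / (of_real pi * x)"
      unfolding eventually_at using True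
      by (intro exI[of _ 1]) (auto simp: dist_commute W notin_Ints_of_dist_less_1)
    then have "(W \<longlongrightarrow> 2 / (of_real pi * x)) (at \<nu>)"
      by (rule tendsto_eventually)
    ultimately show ?thesis by (rule tendsto_unique[rotated]) simp
  qed (rule W)
  then show ?thesis by (simp add: W_def)
qed

section \<open>Cylinder functions\<close>

text \<open>Both kinds satisfy the same linear recurrence, and \<open>d1\<close>, \<open>d2\<close>
  do not depend on the order.\<close>

lemma cylinder_raise:
  assumes "x \<in> - \<real>\<^sub>\<le>\<^sub>0"
  shows "(cylinder d1 d2 \<nu> has_field_derivative
    \<nu> / x * cylinder d1 d2 \<nu> x - cylinder d1 d2 (\<nu> + 1) x) (at x)"
proof -
  have "(cylinder d1 d2 \<nu> has_field_derivative
      d1 * (\<nu> / x * Bessel_J \<nu> x - Bessel_J (\<nu> + 1) x) + d2 * (\<nu> / x * Bessel_Y \<nu> x - Bessel_Y (\<nu> + 1) x)) (at x)"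
    unfolding cylinder_def[abs_def]
    by (intro DERIV_add DERIV_cmult Bessel_J_raise Bessel_Y_raise assms)
  then show ?thesis by (rule DERIV_cong) (simp add: cylinder_def algebra_simps add_divide_distrib)
qed

lemma cylinder_lower:
  assumes "x \<in> - \<real>\<^sub>\<le>\<^sub>0"
  shows "(cylinder d1 d2 \<nu> has_field_derivative
    cylinder d1 d2 (\<nu> - 1) x - \<nu> / x * cylinder d1 d2 \<nu> x) (at x)"
proof -
  have "(cylinder d1 d2 \<nu> has_field_derivative
      d1 * (Bessel_J (\<nu> - 1) x - \<nu> / x * Bessel_J \<nu> x) + d2 * (Bessel_Y (\<nu> - 1) x - \<nu> / x * Bessel_Y \<nu> x)) (at x)"
    unfolding cylinder_def[abs_def]
    by (intro DERIV_add DERIV_cmult Bessel_J_lower Bessel_Y_lower assms)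
  then show ?thesis by (rule DERIV_cong) (simp add: cylinder_def algebra_simps add_divide_distrib)
qed

text \<open>Identical vanishing at order \<open>\<nu>\<close> forces the derivative, and by raising
  also the value at order \<open>\<nu> + 1\<close>, to vanish. At the point 1 this gives two linear
  equations for \<open>d1\<close> and \<open>d2\<close> whose determinant is, up to sign, the
  nonzero Casoratian.\<close>

lemma cylinder_not_identically_zero:
  assumes d: "(d1, d2) \<noteq> (0, 0)"
  shows "\<exists>x\<in>- \<real>\<^sub>\<le>\<^sub>0. cylinder d1 d2 \<nu> x \<noteq> 0"
proof (rule ccontr)
  assume "\<not> ?thesis"
  then have zero: "cylinder d1 d2 \<nu> x = 0" if "x \<in> - \<real>\<^sub>\<le>\<^sub>0" for x using that by auto
  have x: "(1 :: complex) \<in> - \<real>\<^sub>\<le>\<^sub>0" by (simp add: complex_nonpos_Reals_iff)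
  have "(cylinder d1 d2 \<nu> has_field_derivative 0) (at 1)"
    by (rule has_field_derivative_transform_within_open[where f = "\<lambda>_. 0" and S = "- \<real>\<^sub>\<le>\<^sub>0"])
      (use x zero in \<open>auto simp: open_Compl\<close>)
  from DERIV_unique[OF this cylinder_raise[OF x]] have "cylinder d1 d2 (\<nu> + 1) 1 = 0"
    using zero[OF x] by simp
  with zero[OF x] have eqs: "d1 * Bessel_J \<nu> 1 + d2 * Bessel_Y \<nu> 1 = 0"
    "d1 * Bessel_J (\<nu> + 1) 1 + d2 * Bessel_Y (\<nu> + 1) 1 = 0"
    by (simp_all add: cylinder_def)
  define W where "W = Bessel_J (\<nu> + 1) 1 * Bessel_Y \<nu> 1 - Bessel_J \<nu> 1 * Bessel_Y (\<nu> + 1) 1"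
  have "d2 * W = Bessel_J (\<nu> + 1) 1 * (d1 * Bessel_J \<nu> 1 + d2 * Bessel_Y \<nu> 1) -
      Bessel_J \<nu> 1 * (d1 * Bessel_J (\<nu> + 1) 1 + d2 * Bessel_Y (\<nu> + 1) 1)"
    by (simp add: W_def algebra_simps)
  then have "d2 * W = 0" unfolding eqs by simp
  moreover
  have "d1 * W = Bessel_Y \<nu> 1 * (d1 * Bessel_J (\<nu> + 1) 1 + d2 * Bessel_Y (\<nu> + 1) 1) -
      Bessel_Y (\<nu> + 1) 1 * (d1 * Bessel_J \<nu> 1 + d2 * Bessel_Y \<nu> 1)"
    by (simp add: W_def algebra_simps)
  then have "d1 * W = 0" unfolding eqs by simp
  moreover have "W \<noteq> 0"
    unfolding W_def Bessel_J_Bessel_Y_casoratian[OF one_neq_zero] by simp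
  ultimately show False using d by simp
qed

lemma cylinder_family_cylinder:
  assumes "(d1, d2) \<noteq> (0, 0)"
  shows "cylinder_family (cylinder d1 d2) (- \<real>\<^sub>\<le>\<^sub>0)"
proof
  show "open (- \<real>\<^sub>\<le>\<^sub>0 :: complex set)" by (simp add: open_Compl)
  show "connected (- \<real>\<^sub>\<le>\<^sub>0 :: complex set)"
  proof -
    have "(\<real>\<^sub>\<le>\<^sub>0 :: complex set) = complex_of_real ` {..0}" by (auto simp: nonpos_Reals_def)
    then show ?thesis
      using starlike_slotted_complex_plane_left[of 0] by (simp add: starlike_imp_connected)
  qed
qed (use cylinder_lower cylinder_raise cylinder_not_identically_zero[OF assms] in auto)

theorem proposition1p1:
  fixes d1 d2 \<alpha> :: complex and n :: nat and u :: "complex \<Rightarrow> complex"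
  assumes "(d1, d2) \<noteq> (0, 0)"
  defines "u \<equiv> \<lambda>x. Bessel_u d1 d2 n x \<alpha>"
  shows "u meromorphic_on (- \<real>\<^sub>\<le>\<^sub>0) \<and>
    (\<forall>\<^sub>\<approx>x\<in>- \<real>\<^sub>\<le>\<^sub>0.
       Bessel_det d1 d2 (n + 1) x \<alpha> * Bessel_det d1 d2 n x (\<alpha> - 2) \<noteq> 0 \<and>
       u x \<noteq> 0 \<and>
       deriv (deriv u) x =
         (deriv u x)\<^sup>2 / u x - deriv u x / x
         + ((\<alpha> + 2 * of_nat n) * (u x)\<^sup>2 + (- \<alpha> + 2 + 2 * of_nat n)) / x
         + (u x) ^ 3 - 1 / u x)"
proof -
  interpret cylinder_family "cylinder d1 d2" "- \<real>\<^sub>\<le>\<^sub>0"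
    using assms(1) by (rule cylinder_family_cylinder)
  have "Bessel_det d1 d2 k x \<beta> = D k (\<beta> / 2) x" for k x \<beta>
    by (simp add: Bessel_det_def D_def toeplitz_det_def)
  from this[of _ _ \<alpha>] this[of _ _ "\<alpha> - 2"]
  have det: "Bessel_det d1 d2 k x \<alpha> = D k (\<alpha> / 2) x"
    "Bessel_det d1 d2 k x (\<alpha> - 2) = D k (\<alpha> / 2 - 1) x" for k x
    by (simp_all add: diff_divide_distrib)
  have "u = cylinder_family.u (cylinder d1 d2) n (\<alpha> / 2)"
    by (simp add: assms(2) Bessel_u_def det u_def fun_eq_iff)
  then show ?thesis
    using painleve_III[of n "\<alpha> / 2"] by (simp add: det)
qed

end
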